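(* For all $t\ge0$, $$\frac1\varepsilon\int_0^t(B_{s+\varepsilon}-B_s)^2\,ds\longrightarrow\langle B\rangle_t$$ in $\mathbb L^1$ as $\varepsilon\downarrow0$, where $B$ is the $G$-Brownian motion.
   Context: Setting. Fix constants $0<\underline\sigma<\overline\sigma$ and $G(\alpha)=\frac12(\overline\sigma^2\alpha^+-\underline\sigma^2\alpha^-)$. $\Omega=C_0(\mathbb R_+)$ is the space of continuous $\omega:[0,\infty)\to\mathbb R$ with $\omega_0=0$ (topology of locally uniform convergence), with Borel $\sigma$-algebra $\mathscr B(\Omega)$. $\hat{\mathbb E}$ is Peng's $G$-expectation on $\Omega$: a sublinear expectation (monotone, constant preserving, sub-additive, positively homogeneous) under which the canonical process $B$ is a $G$-Brownian motion, i.e. $B_0=0$ and for all $t,s\ge0$ the increment $B_{t+s}-B_t$ is $N(0,[\underline\sigma^2s,\overline\sigma^2s])$-distributed and independent from $(B_{t_1},\dots,B_{t_n})$ for all $0\le t_1\le\dots\le t_n\le t$. Here $\xi\sim N(0,[\underline\sigma^2 s,\overline\sigma^2 s])$ means that for each bounded Lipschitz $\varphi$, $u(r,x)=\hat{\mathbb E}[\varphi(x+\sqrt r\,\xi)]$ is the unique viscosity solution of $\partial_r u=s\,G(\partial^2_{xx}u)$, $u(0,\cdot)=\varphi$; and $Y$ is independent from $X$ if $\hat{\mathbb E}[\varphi(X,Y)]=\hat{\mathbb E}[\hat{\mathbb E}[\varphi(x,Y)]_{x=X}]$ for all bounded Lipschitz $\varphi$. There is a weakly compact family $\mathcal P$ of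 probability measures on $(\Omega,\mathscr B(\Omega))$ with $\hat{\mathbb E}=\sup_{P\in\mathcal P}E_P$. A property holds quasi-surely (q.s.) if it holds outside a set $A$ with $\sup_{P\in\mathcal P}P(A)=0$. $\mathbb L^p$ is the Banach space of (q.s. classes of) measurable $X$ with $\|X\|_p=\hat{\mathbb E}[|X|^p]^{1/p}<\infty$. Quadratic variation: $\langle B\rangle_t=\lim\sum_k(B_{t_{k+1}}-B_{t_k})^2$ in $\mathbb L^2$ over partitions of $[0,t]$ with mesh tending to $0$; $\langle B\rangle$ is continuous and increasing q.s. *)

theory Defs
  imports "HOL-Probability.Probability"
begin

section \<open>The path space\<close>

text \<open>
  Real functions on the half line are encoded as functions on all of \<open>real\<close> that vanish
  at negative times, so that equality of paths is equality on the half line.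
\<close>

typedef cpath = "{w :: real \<Rightarrow> real. continuous_on {0..} w \<and> (\<forall>t\<le>0. w t = 0)}"
  by (rule exI[of _ "\<lambda>_. 0"]) auto

text \<open>The topology of locally uniform convergence.\<close>

instantiation cpath :: topological_space
begin

definition open_cpath :: "cpath set \<Rightarrow> bool" where
  "open_cpath U \<longleftrightarrow> (\<forall>w\<in>U. \<exists>T>0. \<exists>e>0. \<forall>w'.
     (\<forall>t\<in>{0..T}. \<bar>Rep_cpath w' t - Rep_cpath w t\<bar> < e) \<longrightarrow> w' \<in> U)"

instance
proof
  show "open (UNIV :: cpath set)"
    unfolding open_cpath_def by (auto intro: exI[of _ "1::real"])
next
  fix U V :: "cpath set"
  assume UV: "open U" "open V"
  show "open (U \<inter> V)"
    unfolding open_cpath_def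
  proof
    fix w assume "w \<in> U \<inter> V"
    then obtain T1 e1 T2 e2 :: real where
      1: "T1 > 0" "e1 > 0"
         "\<And>w'. (\<forall>t\<in>{0..T1}. \<bar>Rep_cpath w' t - Rep_cpath w t\<bar> < e1) \<Longrightarrow> w' \<in> U" and
      2: "T2 > 0" "e2 > 0"
         "\<And>w'. (\<forall>t\<in>{0..T2}. \<bar>Rep_cpath w' t - Rep_cpath w t\<bar> < e2) \<Longrightarrow> w' \<in> V"
      using UV unfolding open_cpath_def by (metis IntD1 IntD2)
    show "\<exists>T>0. \<exists>e>0. \<forall>w'. (\<forall>t\<in>{0..T}. \<bar>Rep_cpath w' t - Rep_cpath w t\<bar> < e) \<longrightarrow> w' \<in> U \<inter> V"
      using 1(1,2) 2(1,2)
      by (intro exI[of _ "max T1 T2"] exI[of _ "min e1 e2"] conjI allI impI IntI 1(3) 2(3)) auto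
  qed
next
  fix K :: "cpath set set"
  assume "\<forall>U\<in>K. open U"
  then show "open (\<Union>K)"
    unfolding open_cpath_def by (meson UnionE UnionI)
qed

end

definition canonical :: "real \<Rightarrow> cpath \<Rightarrow> real" where
  "canonical t \<omega> = Rep_cpath \<omega> t"


section \<open>Upper expectations and the spaces of p-integrable variables\<close>

definition weak_topology :: "'a::topological_space measure topology" where
  "weak_topology = topology_generated_by
     {{P. prob_space P \<and> sets P = sets borel \<and> (\<integral>x. f x \<partial>P) \<in> U} | (f :: 'a \<Rightarrow> real) U.
        continuous_on UNIV f \<and> bounded (range f) \<and> open U}"

text \<open>
  The real-valued supremum is the upper expectation only for those \<open>X\<close> that are integrable
  under every \<open>P\<close>, with the expectations bounded above.  It is only used for bounded measurable
  \<open>X\<close> and for \<open>|X| powr p\<close> with \<open>X\<close> in \<open>Lspace\<close>.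
\<close>

definition upper_exp :: "'a measure set \<Rightarrow> ('a \<Rightarrow> real) \<Rightarrow> real" where
  "upper_exp PP X = (SUP P\<in>PP. \<integral>\<omega>. X \<omega> \<partial>P)"

text \<open>
  Elements are functions rather than quasi-sure classes; the last two conditions in \<open>Lspace\<close>
  say that the upper expectation of \<open>|X| powr p\<close> is finite.
\<close>

definition Lspace :: "'a::topological_space measure set \<Rightarrow> real \<Rightarrow> ('a \<Rightarrow> real) set" where
  "Lspace PP p = {X \<in> borel_measurable borel.
     (\<forall>P\<in>PP. integrable P (\<lambda>\<omega>. \<bar>X \<omega>\<bar> powr p)) \<and>
     bdd_above ((\<lambda>P. \<integral>\<omega>. \<bar>X \<omega>\<bar> powr p \<partial>P) ` PP)}"

definition Lnorm :: "'a measure set \<Rightarrow> real \<Rightarrow> ('a \<Rightarrow> real) \<Rightarrow> real" where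
  "Lnorm PP p X = upper_exp PP (\<lambda>\<omega>. \<bar>X \<omega>\<bar> powr p) powr (1 / p)"

definition tendsto_L :: "'a::topological_space measure set \<Rightarrow> real \<Rightarrow>
    ('i \<Rightarrow> 'a \<Rightarrow> real) \<Rightarrow> ('a \<Rightarrow> real) \<Rightarrow> 'i filter \<Rightarrow> bool" where
  "tendsto_L PP p X Y F \<longleftrightarrow>
     Y \<in> Lspace PP p \<and> (\<forall>\<^sub>F i in F. X i \<in> Lspace PP p) \<and>
     ((\<lambda>i. Lnorm PP p (\<lambda>\<omega>. X i \<omega> - Y \<omega>)) \<longlongrightarrow> 0) F"


section \<open>The G-normal distribution\<close>

text \<open>The parameters \<open>sl\<close> and \<open>su\<close> are the lower and the upper volatility.\<close>

definition G_fun :: "real \<Rightarrow> real \<Rightarrow> real \<Rightarrow> real" where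
  "G_fun sl su a = (su\<^sup>2 * max a 0 - sl\<^sup>2 * max (- a) 0) / 2"

text \<open>
  \<open>\<psi>\<close> is of class C(1,2) on the open half plane, with time derivative \<open>\<psi>r\<close> and
  space derivatives \<open>\<psi>x\<close>, \<open>\<psi>xx\<close>.
\<close>

definition C12 :: "(real \<times> real \<Rightarrow> real) \<Rightarrow> (real \<times> real \<Rightarrow> real) \<Rightarrow>
    (real \<times> real \<Rightarrow> real) \<Rightarrow> (real \<times> real \<Rightarrow> real) \<Rightarrow> bool" where
  "C12 \<psi> \<psi>r \<psi>x \<psi>xx \<longleftrightarrow>
     (\<forall>r>0. \<forall>x.
        ((\<lambda>r'. \<psi> (r', x)) has_real_derivative \<psi>r (r, x)) (at r) \<and>
        ((\<lambda>x'. \<psi> (r, x')) has_real_derivative \<psi>x (r, x)) (at x) \<and>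
        ((\<lambda>x'. \<psi>x (r, x')) has_real_derivative \<psi>xx (r, x)) (at x)) \<and>
     (\<forall>f\<in>{\<psi>, \<psi>r, \<psi>x, \<psi>xx}. continuous_on ({0<..} \<times> UNIV) f)"

definition viscosity_subsolution :: "(real \<Rightarrow> real) \<Rightarrow> (real \<times> real \<Rightarrow> real) \<Rightarrow> bool" where
  "viscosity_subsolution H u \<longleftrightarrow>
     (\<forall>\<psi> \<psi>r \<psi>x \<psi>xx. \<forall>r>0. \<forall>x.
        C12 \<psi> \<psi>r \<psi>x \<psi>xx \<longrightarrow>
        (\<forall>\<^sub>F z in nhds (r, x). u z - \<psi> z \<le> u (r, x) - \<psi> (r, x)) \<longrightarrow>
        \<psi>r (r, x) \<le> H (\<psi>xx (r, x)))"

definition viscosity_supersolution :: "(real \<Rightarrow> real) \<Rightarrow> (real \<times> real \<Rightarrow> real) \<Rightarrow> bool" where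
  "viscosity_supersolution H u \<longleftrightarrow>
     (\<forall>\<psi> \<psi>r \<psi>x \<psi>xx. \<forall>r>0. \<forall>x.
        C12 \<psi> \<psi>r \<psi>x \<psi>xx \<longrightarrow>
        (\<forall>\<^sub>F z in nhds (r, x). u z - \<psi> z \<ge> u (r, x) - \<psi> (r, x)) \<longrightarrow>
        \<psi>r (r, x) \<ge> H (\<psi>xx (r, x)))"

text \<open>
  Viscosity solution of the Cauchy problem for \<open>u_r = H (u_xx)\<close> with initial value \<open>\<phi>\<close>.
\<close>

definition viscosity_solution ::
    "(real \<Rightarrow> real) \<Rightarrow> (real \<Rightarrow> real) \<Rightarrow> (real \<times> real \<Rightarrow> real) \<Rightarrow> bool" where
  "viscosity_solution H \<phi> u \<longleftrightarrow>
     continuous_on ({0..} \<times> UNIV) u \<and> (\<forall>x. u (0, x) = \<phi> x) \<and>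
     viscosity_subsolution H u \<and> viscosity_supersolution H u"

text \<open>
  The law N(0, [sl^2 s, su^2 s]).  The function of \<open>(r, x)\<close> below is bounded because \<open>\<phi>\<close> is,
  and bounded viscosity solutions are unique (comparison principle), so requiring it to be
  a solution identifies it with the unique one.
\<close>

definition G_normal ::
    "real \<Rightarrow> real \<Rightarrow> 'a measure set \<Rightarrow> real \<Rightarrow> ('a \<Rightarrow> real) \<Rightarrow> bool" where
  "G_normal sl su PP s \<xi> \<longleftrightarrow>
     (\<forall>\<phi> :: real \<Rightarrow> real. bounded (range \<phi>) \<longrightarrow> (\<exists>L. L-lipschitz_on UNIV \<phi>) \<longrightarrow>
        viscosity_solution (\<lambda>a. s * G_fun sl su a) \<phi>
          (\<lambda>(r, x). upper_exp PP (\<lambda>\<omega>. \<phi> (x + sqrt r * \<xi> \<omega>))))"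


section \<open>G-Brownian motion\<close>

text \<open>
  The variable \<open>Y\<close> is independent from the vector \<open>(X 0, \<dots>, X (n - 1))\<close>.  The Lipschitz
  condition on \<open>\<phi>\<close> involves only the coordinates below \<open>n\<close> and therefore forces \<open>\<phi>\<close>
  to depend on them only.
\<close>

definition indep_from ::
    "'a measure set \<Rightarrow> nat \<Rightarrow> (nat \<Rightarrow> 'a \<Rightarrow> real) \<Rightarrow> ('a \<Rightarrow> real) \<Rightarrow> bool" where
  "indep_from PP n X Y \<longleftrightarrow>
     (\<forall>\<phi> :: (nat \<Rightarrow> real) \<Rightarrow> real \<Rightarrow> real.
        (\<exists>M. \<forall>x y. \<bar>\<phi> x y\<bar> \<le> M) \<longrightarrow>
        (\<exists>L. \<forall>x x' y y'. \<bar>\<phi> x y - \<phi> x' y'\<bar> \<le> L * ((\<Sum>i<n. \<bar>x i - x' i\<bar>) + \<bar>y - y'\<bar>)) \<longrightarrow>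
        upper_exp PP (\<lambda>\<omega>. \<phi> (\<lambda>i. X i \<omega>) (Y \<omega>)) =
        upper_exp PP (\<lambda>\<omega>. upper_exp PP (\<lambda>\<omega>'. \<phi> (\<lambda>i. X i \<omega>) (Y \<omega>'))))"

definition G_Brownian_motion ::
    "real \<Rightarrow> real \<Rightarrow> 'a measure set \<Rightarrow> (real \<Rightarrow> 'a \<Rightarrow> real) \<Rightarrow> bool" where
  "G_Brownian_motion sl su PP X \<longleftrightarrow>
     (\<forall>\<omega>. X 0 \<omega> = 0) \<and>
     (\<forall>t\<ge>0. \<forall>s\<ge>0.
        G_normal sl su PP s (\<lambda>\<omega>. X (t + s) \<omega> - X t \<omega>) \<and>
        (\<forall>n \<tau>. (\<forall>i<n. 0 \<le> \<tau> i \<and> \<tau> i \<le> t) \<longrightarrow> mono_on {..<n} \<tau> \<longrightarrow>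
           indep_from PP n (\<lambda>i. X (\<tau> i)) (\<lambda>\<omega>. X (t + s) \<omega> - X t \<omega>)))"

text \<open>
  \<open>upper_exp PP\<close> is the G-expectation.  Monotonicity, preservation of constants, subadditivity
  and positive homogeneity hold for every upper expectation over a nonempty set of probability
  measures.
\<close>

definition represents_G_expectation :: "real \<Rightarrow> real \<Rightarrow> cpath measure set \<Rightarrow> bool" where
  "represents_G_expectation sl su PP \<longleftrightarrow>
     PP \<noteq> {} \<and> compactin weak_topology PP \<and> G_Brownian_motion sl su PP canonical"


section \<open>Quadratic variation\<close>

text \<open>
  A partition \<open>0 = \<tau> 0 \<le> \<dots> \<le> \<tau> n = t\<close> is the pair \<open>(n, \<tau>)\<close>; the filter describes mesh
  tending to zero.
\<close>

definition partitions_mesh :: "real \<Rightarrow> (nat \<times> (nat \<Rightarrow> real)) filter" where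
  "partitions_mesh t = (INF d\<in>{0<..}. principal
     {(n, \<tau>). \<tau> 0 = 0 \<and> \<tau> n = t \<and> (\<forall>k<n. \<tau> k \<le> \<tau> (Suc k) \<and> \<tau> (Suc k) - \<tau> k < d)})"

text \<open>Any version of the quadratic variation process is allowed.\<close>

definition is_quadratic_variation ::
    "'a::topological_space measure set \<Rightarrow> (real \<Rightarrow> 'a \<Rightarrow> real) \<Rightarrow> (real \<Rightarrow> 'a \<Rightarrow> real) \<Rightarrow> bool" where
  "is_quadratic_variation PP X QV \<longleftrightarrow>
     (\<forall>t\<ge>0. tendsto_L PP 2
        (\<lambda>(n, \<tau>) \<omega>. \<Sum>k<n. (X (\<tau> (Suc k)) \<omega> - X (\<tau> k) \<omega>)\<^sup>2) (QV t) (partitions_mesh t))"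

end

theory Submission imports Defs begin

text \<open>
  Summing the squared increments over the grid of step \<open>\<epsilon>\<close> shifted by \<open>u\<close> and stopped at \<open>0\<close> and
  \<open>t\<close>, and averaging over \<open>u \<in> [0, \<epsilon>]\<close>, gives the regularized quadratic variation up to
  contributions of two time intervals of length at most \<open>\<epsilon>\<close>, at \<open>0\<close> and at \<open>t\<close>.  All these grids have
  mesh at most \<open>\<epsilon>\<close>, so their sums are close to the quadratic variation uniformly in \<open>u\<close>, and by
  Tonelli so is their average.

  The two boundary contributions are small because squared increments over short intervals have
  uniformly small upper expectation.  This needs no knowledge of their law: the modulus of continuity,
  truncated at 1, decreases to 0 pointwise, hence by weak compactness of the representing set (Dini)
  uniformly in expectation; and fourth moments of increments are bounded since squared increments are
  dominated by partition sums, which converge in the second norm.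
\<close>

section \<open>Upper expectations and norms in terms of nonnegative integrals\<close>

text \<open>For nonnegative integrands, integrability under each \<open>P\<close> and boundedness of
  the expectations merge into one uniform bound in \<open>ennreal\<close>. The later moment
  estimates are made in that form and so avoid integrability side conditions.\<close>

lemma Lspace_iff:
  fixes PP :: "'a::topological_space measure set"
  assumes "\<forall>P\<in>PP. sets P = sets borel"
  shows "X \<in> Lspace PP p \<longleftrightarrow> X \<in> borel_measurable borel \<and>
    (\<exists>C\<ge>0. \<forall>P\<in>PP. (\<integral>\<^sup>+\<omega>. ennreal (\<bar>X \<omega>\<bar> powr p) \<partial>P) \<le> ennreal C)"
proof (intro iffI conjI)
  assume X: "X \<in> Lspace PP p"
  then show "X \<in> borel_measurable borel" by (simp add: Lspace_def)
  from X obtain C where C: "\<And>P. P \<in> PP \<Longrightarrow> (\<integral>\<omega>. \<bar>X \<omega>\<bar> powr p \<partial>P) \<le> C"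
    unfolding Lspace_def bdd_above_def by auto
  have "(\<integral>\<^sup>+\<omega>. ennreal (\<bar>X \<omega>\<bar> powr p) \<partial>P) \<le> ennreal C" if "P \<in> PP" for P
    using that C[OF that] X unfolding Lspace_def
    by (subst nn_integral_eq_integral) (auto intro: ennreal_leI)
  then show "\<exists>C\<ge>0. \<forall>P\<in>PP. (\<integral>\<^sup>+\<omega>. ennreal (\<bar>X \<omega>\<bar> powr p) \<partial>P) \<le> ennreal C"
    by (intro exI[of _ "max C 0"]) simp
next
  assume "X \<in> borel_measurable borel \<and>
    (\<exists>C\<ge>0. \<forall>P\<in>PP. (\<integral>\<^sup>+\<omega>. ennreal (\<bar>X \<omega>\<bar> powr p) \<partial>P) \<le> ennreal C)"
  then obtain C where X: "X \<in> borel_measurable borel"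
    and C: "\<And>P. P \<in> PP \<Longrightarrow> (\<integral>\<^sup>+\<omega>. ennreal (\<bar>X \<omega>\<bar> powr p) \<partial>P) \<le> ennreal C" by blast
  have int: "integrable P (\<lambda>\<omega>. \<bar>X \<omega>\<bar> powr p)" if "P \<in> PP" for P
  proof (rule integrableI_bounded)
    have "X \<in> borel_measurable P"
      using X measurable_cong_sets[OF bspec[OF assms that] refl] by blast
    then show "(\<lambda>\<omega>. \<bar>X \<omega>\<bar> powr p) \<in> borel_measurable P" by measurable
    show "(\<integral>\<^sup>+\<omega>. norm (\<bar>X \<omega>\<bar> powr p) \<partial>P) < \<infinity>"
      using C[OF that] le_less_trans by fastforce
  qed
  have "(\<integral>\<omega>. \<bar>X \<omega>\<bar> powr p \<partial>P) \<le> max C 0" if "P \<in> PP" for P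
    using C[OF that] int[OF that]
    by (subst (asm) nn_integral_eq_integral) (auto simp: ennreal_le_iff2)
  then show "X \<in> Lspace PP p"
    using X int unfolding Lspace_def bdd_above_def by auto
qed

text \<open>The supremum over an empty family would be meaningless, hence the condition on
  \<open>PP\<close>; membership in \<open>Lspace\<close> turns the nonnegative integrals into
  expectations.\<close>

lemma Lnorm_1_le:
  assumes "PP \<noteq> {}" "X \<in> Lspace PP 1" "0 \<le> c"
    and "\<And>P. P \<in> PP \<Longrightarrow> (\<integral>\<^sup>+\<omega>. ennreal \<bar>X \<omega>\<bar> \<partial>P) \<le> ennreal c"
  shows "Lnorm PP 1 X \<le> c"
proof -
  have *: "0 \<le> (\<integral>\<omega>. \<bar>X \<omega>\<bar> powr 1 \<partial>P)" "(\<integral>\<omega>. \<bar>X \<omega>\<bar> powr 1 \<partial>P) \<le> c" if "P \<in> PP" for P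
  proof -
    have "integrable P (\<lambda>\<omega>. \<bar>X \<omega>\<bar> powr 1)" using assms(2) that by (auto simp: Lspace_def)
    then have "(\<integral>\<^sup>+\<omega>. ennreal (\<bar>X \<omega>\<bar> powr 1) \<partial>P) = ennreal (\<integral>\<omega>. \<bar>X \<omega>\<bar> powr 1 \<partial>P)"
      by (rule nn_integral_eq_integral) auto
    then show "(\<integral>\<omega>. \<bar>X \<omega>\<bar> powr 1 \<partial>P) \<le> c" using assms(4)[OF that] assms(3) by simp
  qed (auto intro: integral_nonneg_AE)
  then have "upper_exp PP (\<lambda>\<omega>. \<bar>X \<omega>\<bar> powr 1) \<le> c"
    unfolding upper_exp_def by (intro cSUP_least assms(1))
  \<comment> \<open>The outer \<open>powr\<close> with exponent 1 is the identity only on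
    nonnegative reals.\<close>
  moreover have "0 \<le> upper_exp PP (\<lambda>\<omega>. \<bar>X \<omega>\<bar> powr 1)"
  proof -
    obtain P where P: "P \<in> PP" using assms(1) by blast
    have "bdd_above ((\<lambda>P. \<integral>\<omega>. \<bar>X \<omega>\<bar> powr 1 \<partial>P) ` PP)"
      using *(2) by (intro bdd_aboveI[of _ c]) blast
    from cSUP_upper[OF P this] show ?thesis
      unfolding upper_exp_def using *(1)[OF P] by (rule order_trans[rotated])
  qed
  ultimately show ?thesis by (simp add: Lnorm_def)
qed

text \<open>The real supremum inside \<open>Lnorm\<close> dominates each expectation because
  membership in \<open>Lspace\<close> makes the family of expectations bounded above.\<close>

lemma nn_integral_square_le_Lnorm:
  assumes "X \<in> Lspace PP 2" "Lnorm PP 2 X \<le> e" "P \<in> PP"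
  shows "(\<integral>\<^sup>+\<omega>. ennreal ((X \<omega>)\<^sup>2) \<partial>P) \<le> ennreal (e\<^sup>2)"
proof -
  have i: "integrable P (\<lambda>\<omega>. (X \<omega>)\<^sup>2)"
    and b: "bdd_above ((\<lambda>P. \<integral>\<omega>. (X \<omega>)\<^sup>2 \<partial>P) ` PP)"
    using assms(1,3) by (auto simp: Lspace_def)
  have "(\<integral>\<omega>. (X \<omega>)\<^sup>2 \<partial>P) \<le> upper_exp PP (\<lambda>\<omega>. (X \<omega>)\<^sup>2)"
    unfolding upper_exp_def by (rule cSUP_upper[OF assms(3) b])
  also have "\<dots> \<le> e\<^sup>2"
  proof -
    have "0 \<le> (\<integral>\<omega>. (X \<omega>)\<^sup>2 \<partial>P)" by (auto intro: integral_nonneg_AE)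
    then have "0 \<le> upper_exp PP (\<lambda>\<omega>. (X \<omega>)\<^sup>2)"
      using calculation by linarith
    moreover have "sqrt (upper_exp PP (\<lambda>\<omega>. (X \<omega>)\<^sup>2)) \<le> e"
      using assms(2) calculation by (simp add: Lnorm_def powr_half_sqrt)
    ultimately show ?thesis by (metis real_sqrt_ge_0_iff real_sqrt_pow2 power_mono)
  qed
  finally show ?thesis
    using i by (subst nn_integral_eq_integral) (auto intro: ennreal_leI)
qed

text \<open>The weighted inequality \<open>amgm\<close> stands in for Cauchy-Schwarz: with weight
  \<open>e\<close>, the quadratic term and the constant term contribute \<open>e / 2\<close>
  each.\<close>

lemma nn_integral_abs_le_of_square:
  assumes "prob_space P" "X \<in> borel_measurable P" "0 < e"
    and "(\<integral>\<^sup>+\<omega>. ennreal ((X \<omega>)\<^sup>2) \<partial>P) \<le> ennreal (e\<^sup>2)"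
  shows "(\<integral>\<^sup>+\<omega>. ennreal \<bar>X \<omega>\<bar> \<partial>P) \<le> ennreal e"
proof -
  interpret prob_space P by fact
  note [measurable] = assms(2)
  have amgm: "\<bar>x\<bar> \<le> 1 / (2 * e) * x\<^sup>2 + e / 2" for x :: real
  proof -
    have "0 \<le> (\<bar>x\<bar> - e)\<^sup>2 / (2 * e)" using assms(3) by simp
    also have "\<dots> = 1 / (2 * e) * x\<^sup>2 + e / 2 - \<bar>x\<bar>"
      using assms(3) by (simp add: power2_eq_square field_simps)
    finally show ?thesis by simp
  qed
  have "(\<integral>\<^sup>+\<omega>. ennreal \<bar>X \<omega>\<bar> \<partial>P)
      \<le> (\<integral>\<^sup>+\<omega>. ennreal (1 / (2 * e)) * ennreal ((X \<omega>)\<^sup>2) + ennreal (e / 2) \<partial>P)"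
    using assms(3) amgm
    by (intro nn_integral_mono) (simp add: ennreal_leI flip: ennreal_mult ennreal_plus)
  also have "\<dots> = ennreal (1 / (2 * e)) * (\<integral>\<^sup>+\<omega>. ennreal ((X \<omega>)\<^sup>2) \<partial>P) + ennreal (e / 2)"
    by (simp add: nn_integral_add nn_integral_cmult emeasure_space_1)
  also have "\<dots> \<le> ennreal (1 / (2 * e)) * ennreal (e\<^sup>2) + ennreal (e / 2)"
    by (intro add_right_mono mult_left_mono assms(4)) simp
  also have "\<dots> = ennreal e"
    using assms(3) by (simp add: power2_eq_square field_simps flip: ennreal_mult ennreal_plus)
  finally show ?thesis .
qed

text \<open>Tonelli, after moving the absolute value inside the time integral. A bound uniform in
  \<open>s\<close> thus passes to the time integral at the cost of the length of
  \<open>A\<close>.\<close>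

lemma nn_integral_abs_set_integral_le:
  fixes f :: "real \<Rightarrow> 'a \<Rightarrow> real"
  assumes "sigma_finite_measure P" and f: "case_prod f \<in> borel_measurable (lborel \<Otimes>\<^sub>M P)"
    and A: "A \<in> sets borel"
    and C: "\<And>s. s \<in> A \<Longrightarrow> (\<integral>\<^sup>+\<omega>. ennreal \<bar>f s \<omega>\<bar> \<partial>P) \<le> C"
  shows "(\<integral>\<^sup>+\<omega>. ennreal \<bar>LBINT s:A. f s \<omega>\<bar> \<partial>P) \<le> C * emeasure lborel A"
proof -
  interpret P: sigma_finite_measure P by fact
  interpret pair_sigma_finite lborel P ..
  note [measurable] = f A
  have "ennreal \<bar>LBINT s:A. f s \<omega>\<bar> \<le> (\<integral>\<^sup>+s. ennreal \<bar>f s \<omega>\<bar> * indicator A s \<partial>lborel)" for \<omega>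
  proof (cases "set_integrable lborel A (\<lambda>s. f s \<omega>)")
    case True
    then have "ennreal \<bar>LBINT s:A. f s \<omega>\<bar>
        \<le> (\<integral>\<^sup>+s. norm (indicator A s *\<^sub>R f s \<omega>) \<partial>lborel)"
      unfolding set_lebesgue_integral_def set_integrable_def
      by (metis integral_norm_bound_ennreal real_norm_def)
    also have "\<dots> = (\<integral>\<^sup>+s. ennreal \<bar>f s \<omega>\<bar> * indicator A s \<partial>lborel)"
      by (intro nn_integral_cong) (auto simp: indicator_def)
    finally show ?thesis .
  next
    \<comment> \<open>Without integrability the Bochner integral is 0 by convention.\<close>
    case False
    then show ?thesis
      by (simp add: set_lebesgue_integral_def set_integrable_def not_integrable_integral_eq)
  qed
  then have "(\<integral>\<^sup>+\<omega>. ennreal \<bar>LBINT s:A. f s \<omega>\<bar> \<partial>P)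
      \<le> (\<integral>\<^sup>+\<omega>. (\<integral>\<^sup>+s. ennreal \<bar>f s \<omega>\<bar> * indicator A s \<partial>lborel) \<partial>P)"
    by (intro nn_integral_mono)
  also have "\<dots> = (\<integral>\<^sup>+s. (\<integral>\<^sup>+\<omega>. ennreal \<bar>f s \<omega>\<bar> * indicator A s \<partial>P) \<partial>lborel)"
    by (rule Fubini') measurable
  also have "\<dots> \<le> (\<integral>\<^sup>+s. C * indicator A s \<partial>lborel)"
    using C by (intro nn_integral_mono) (auto simp: indicator_def)
  also have "\<dots> = C * emeasure lborel A"
    by (simp add: nn_integral_cmult_indicator)
  finally show ?thesis .
qed

section \<open>Averages of sums over shifted grids\<close>

lemma set_lborel_integral_Icc:
  fixes f :: "real \<Rightarrow> real"
  assumes "continuous_on {a..b} f"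
  shows "(LBINT s:{a..b}. f s) = integral {a..b} f"
  using assms by (intro set_borel_integral_eq_integral borel_integrable_atLeastAtMost')

text \<open>The translates of \<open>{0..\<epsilon>}\<close> by \<open>a + k * \<epsilon>\<close>
  tile the interval on the right. This turns the average over the shift \<open>u\<close> of a sum
  over grid cells into a single time integral.\<close>

lemma integral_periodize:
  fixes h :: "real \<Rightarrow> real"
  assumes h: "continuous_on UNIV h" and "0 \<le> \<epsilon>"
  shows "integral {0..\<epsilon>} (\<lambda>u. \<Sum>k<n. h (u + (a + real k * \<epsilon>))) = integral {a..a + real n * \<epsilon>} h"
proof (induction n)
  case (Suc n)
  have c: "continuous_on A (\<lambda>u. h (u + c))" for A c
    by (rule continuous_on_compose2[OF h]) (auto intro!: continuous_intros)
  have i: "h integrable_on {x..y}" for x y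
    using h by (meson integrable_continuous_real continuous_on_subset subset_UNIV)
  have "integral {0..\<epsilon>} (\<lambda>u. \<Sum>k<Suc n. h (u + (a + real k * \<epsilon>)))
      = integral {0..\<epsilon>} (\<lambda>u. \<Sum>k<n. h (u + (a + real k * \<epsilon>)))
        + integral {0..\<epsilon>} (\<lambda>u. h (u + (a + real n * \<epsilon>)))"
    by (simp, rule integral_add) (intro integrable_continuous_real continuous_intros c)+
  also have "integral {0..\<epsilon>} (\<lambda>u. h (u + (a + real n * \<epsilon>)))
      = integral {a + real n * \<epsilon>..a + real (Suc n) * \<epsilon>} h"
    using integral_shift_Icc_real[of 0 \<epsilon> h "a + real n * \<epsilon>"]
    by (simp add: o_def algebra_simps)
  also have "integral {0..\<epsilon>} (\<lambda>u. \<Sum>k<n. h (u + (a + real k * \<epsilon>))) + \<dots>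
      = integral {a..a + real (Suc n) * \<epsilon>} h"
    unfolding Suc using assms(2)
    by (intro Henstock_Kurzweil_Integration.integral_combine i) (auto simp: algebra_simps)
  finally show ?case .
qed simp

section \<open>Continuity and measurability on the path space\<close>

lemma canonical_nonpos: "s \<le> 0 \<Longrightarrow> canonical s \<omega> = 0"
  using Rep_cpath[of \<omega>] by (simp add: canonical_def)

lemma canonical_max_0: "canonical (max 0 s) \<omega> = canonical s \<omega>"
  by (cases "s \<le> 0") (auto simp: canonical_nonpos max_def)

lemma continuous_on_canonical: "continuous_on A (\<lambda>s. canonical s \<omega>)"
proof -
  have "continuous_on ({..0} \<union> {0..}) (\<lambda>s. canonical s \<omega>)"
  proof (rule continuous_on_closed_Un)
    show "continuous_on {..0} (\<lambda>s. canonical s \<omega>)"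
      by (rule continuous_on_eq[OF continuous_on_const[of _ 0]]) (simp add: canonical_nonpos)
    show "continuous_on {0..} (\<lambda>s. canonical s \<omega>)"
      using Rep_cpath[of \<omega>] by (simp add: canonical_def[abs_def])
  qed auto
  then show ?thesis by (rule continuous_on_subset) auto
qed

text \<open>A Lipschitz estimate in the uniform distance on \<open>{0..T}\<close> suffices, as such
  distances generate the topology.\<close>

lemma continuous_on_cpathI:
  fixes f :: "cpath \<Rightarrow> real"
  assumes "\<And>\<omega> \<omega>' e. (\<forall>t\<in>{0..T}. \<bar>canonical t \<omega>' - canonical t \<omega>\<bar> < e) \<Longrightarrow> \<bar>f \<omega>' - f \<omega>\<bar> \<le> C * e"
  shows "continuous_on UNIV f"
  unfolding continuous_on_open_vimage[OF open_UNIV]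
proof (intro allI impI, simp)
  fix B :: "real set" assume B: "open B"
  show "open (f -` B)"
    unfolding open_cpath_def
  proof
    fix \<omega> assume "\<omega> \<in> f -` B"
    then obtain d where d: "0 < d" "\<And>y. dist y (f \<omega>) < d \<Longrightarrow> y \<in> B"
      using B unfolding open_dist by (metis vimageD)
    \<comment> \<open>\<open>C\<close> and \<open>T\<close> carry no sign condition;
      \<open>\<bar>C\<bar> + 1\<close> and \<open>max T 1\<close> are positive substitutes.\<close>
    define e where "e = d / (2 * (\<bar>C\<bar> + 1))"
    have "0 < e" using d(1) by (simp add: e_def)
    have "C * e \<le> (\<bar>C\<bar> + 1) * e" using \<open>0 < e\<close> by (intro mult_right_mono) auto
    also have "\<dots> = d / 2"
      using abs_ge_zero[of C] by (simp add: e_def field_simps del: abs_ge_zero)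
    also have "\<dots> < d" using d(1) by simp
    finally have "C * e < d" .
    have "\<omega>' \<in> f -` B" if "\<forall>t\<in>{0..max T 1}. \<bar>Rep_cpath \<omega>' t - Rep_cpath \<omega> t\<bar> < e" for \<omega>'
    proof -
      have "\<bar>f \<omega>' - f \<omega>\<bar> \<le> C * e" using that by (intro assms) (auto simp: canonical_def)
      then show ?thesis using d(2) \<open>C * e < d\<close> by (auto simp: dist_real_def)
    qed
    then show "\<exists>T>0. \<exists>e>0. \<forall>w'. (\<forall>t\<in>{0..T}. \<bar>Rep_cpath w' t - Rep_cpath \<omega> t\<bar> < e) \<longrightarrow> w' \<in> f -` B"
      using \<open>0 < e\<close> by (intro exI[of _ "max T 1"] exI[of _ e]) auto
  qed
qed

lemma borel_measurable_canonical: "canonical s \<in> borel_measurable borel"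
proof (intro borel_measurable_continuous_onI continuous_on_cpathI[of "max 0 s" _ 1])
  fix \<omega> \<omega>' e assume *: "\<forall>t\<in>{0..max 0 s}. \<bar>canonical t \<omega>' - canonical t \<omega>\<bar> < e"
  then show "\<bar>canonical s \<omega>' - canonical s \<omega>\<bar> \<le> 1 * e"
    using *[rule_format, of "max 0 s"] by (simp add: canonical_max_0)
qed

text \<open>Joint measurability in time and path: rounding the time down to a multiple of
  \<open>1 / Suc i\<close> leaves countably many values, at each of which evaluation is measurable,
  and path continuity passes to the limit.\<close>

lemma borel_measurable_canonical_compose [measurable (raw)]:
  assumes [measurable]: "g \<in> borel_measurable N" "p \<in> N \<rightarrow>\<^sub>M borel"
  shows "(\<lambda>z. canonical (g z) (p z)) \<in> borel_measurable N"
proof (rule borel_measurable_LIMSEQ_real)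
  fix z
  have "(\<lambda>i. real_of_int \<lfloor>real (Suc i) * g z\<rfloor> / real (Suc i)) \<longlonglongrightarrow> g z"
  proof (rule real_tendsto_sandwich)
    show "(\<lambda>i. g z - 1 / real (Suc i)) \<longlonglongrightarrow> g z"
      using tendsto_diff[OF tendsto_const[of "g z"] LIMSEQ_Suc[OF lim_1_over_n]] by simp
    show "\<forall>\<^sub>F i in sequentially. g z - 1 / real (Suc i) \<le> real_of_int \<lfloor>real (Suc i) * g z\<rfloor> / real (Suc i)"
    proof (intro always_eventually allI)
      fix i
      have "g z - 1 / real (Suc i) = (real (Suc i) * g z - 1) / real (Suc i)"
        by (simp add: diff_divide_distrib del: of_nat_Suc)
      also have "\<dots> \<le> real_of_int \<lfloor>real (Suc i) * g z\<rfloor> / real (Suc i)"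
        by (intro divide_right_mono) (linarith, simp)
      finally show "g z - 1 / real (Suc i) \<le> real_of_int \<lfloor>real (Suc i) * g z\<rfloor> / real (Suc i)" .
    qed
    show "\<forall>\<^sub>F i in sequentially. real_of_int \<lfloor>real (Suc i) * g z\<rfloor> / real (Suc i) \<le> g z"
    proof (intro always_eventually allI)
      fix i
      have "real_of_int \<lfloor>real (Suc i) * g z\<rfloor> \<le> real (Suc i) * g z" by linarith
      then show "real_of_int \<lfloor>real (Suc i) * g z\<rfloor> / real (Suc i) \<le> g z"
        by (simp add: field_simps del: of_nat_Suc)
    qed
  qed simp
  then show "(\<lambda>i. canonical (real_of_int \<lfloor>real (Suc i) * g z\<rfloor> / real (Suc i)) (p z)) \<longlonglongrightarrow> canonical (g z) (p z)"
    by (intro continuous_on_tendsto_compose[OF continuous_on_canonical[of UNIV]]) auto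
next
  fix i
  note [measurable] = borel_measurable_canonical
  show "(\<lambda>z. canonical (real_of_int \<lfloor>real (Suc i) * g z\<rfloor> / real (Suc i)) (p z)) \<in> borel_measurable N"
    by (rule measurable_compose_countable[where f="\<lambda>j z. canonical (real_of_int j / real (Suc i)) (p z)"
          and g="\<lambda>z. \<lfloor>real (Suc i) * g z\<rfloor>"]) measurable
qed

section \<open>The modulus of continuity of a path\<close>

definition modulus_pairs :: "real \<Rightarrow> real \<Rightarrow> (real \<times> real) set" where
  "modulus_pairs T \<delta> = {(p, q). 0 \<le> p \<and> p \<le> q \<and> q \<le> T \<and> q - p \<le> \<delta>}"

definition modulus :: "real \<Rightarrow> real \<Rightarrow> cpath \<Rightarrow> real" where
  "modulus T \<delta> \<omega> = (SUP (p, q)\<in>modulus_pairs T \<delta>. \<bar>canonical q \<omega> - canonical p \<omega>\<bar>)"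

lemma modulus_pairs_nonempty: "0 \<le> T \<Longrightarrow> 0 \<le> \<delta> \<Longrightarrow> modulus_pairs T \<delta> \<noteq> {}"
  by (auto simp: modulus_pairs_def intro!: exI[of _ 0])

lemma bdd_above_modulus:
  "bdd_above ((\<lambda>(p, q). \<bar>canonical q \<omega> - canonical p \<omega>\<bar>) ` modulus_pairs T \<delta>)"
proof -
  have "bounded ((\<lambda>s. canonical s \<omega>) ` {0..T})"
    by (intro compact_imp_bounded compact_continuous_image continuous_on_canonical) auto
  then obtain K where K: "\<And>s. s \<in> {0..T} \<Longrightarrow> \<bar>canonical s \<omega>\<bar> \<le> K"
    unfolding bounded_iff real_norm_def by blast
  show ?thesis
    by (rule bdd_aboveI[of _ "2 * K"])
      (auto simp: modulus_pairs_def intro!: order_trans[OF abs_triangle_ineq4] order_trans[OF add_mono[OF K K]])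
qed

lemma modulus_upper:
  assumes "0 \<le> p" "p \<le> q" "q \<le> T" "q - p \<le> \<delta>"
  shows "\<bar>canonical q \<omega> - canonical p \<omega>\<bar> \<le> modulus T \<delta> \<omega>"
  unfolding modulus_def
  using cSUP_upper[OF _ bdd_above_modulus, of "(p, q)" T \<delta> \<omega>] assms
  by (simp add: modulus_pairs_def)

lemma modulus_least:
  assumes "0 \<le> T" "0 \<le> \<delta>"
    and "\<And>p q. 0 \<le> p \<Longrightarrow> p \<le> q \<Longrightarrow> q \<le> T \<Longrightarrow> q - p \<le> \<delta> \<Longrightarrow> \<bar>canonical q \<omega> - canonical p \<omega>\<bar> \<le> K"
  shows "modulus T \<delta> \<omega> \<le> K"
  unfolding modulus_def using assms(3)
  by (intro cSUP_least modulus_pairs_nonempty assms(1,2)) (auto simp: modulus_pairs_def)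

lemma modulus_nonneg: "0 \<le> T \<Longrightarrow> 0 \<le> \<delta> \<Longrightarrow> 0 \<le> modulus T \<delta> \<omega>"
  using modulus_upper[of 0 0 T \<delta> \<omega>] by simp

lemma modulus_mono: "0 \<le> T \<Longrightarrow> 0 \<le> \<delta> \<Longrightarrow> \<delta> \<le> \<delta>' \<Longrightarrow> modulus T \<delta> \<omega> \<le> modulus T \<delta>' \<omega>"
  by (intro modulus_least modulus_upper) auto

text \<open>If two paths differ by less than \<open>e\<close> on \<open>{0..T}\<close>, each
  increment changes by at most \<open>2 * e\<close>, and so does the supremum.\<close>

lemma continuous_on_modulus:
  assumes "0 \<le> T" "0 \<le> \<delta>"
  shows "continuous_on UNIV (modulus T \<delta>)"
proof (rule continuous_on_cpathI[of T _ 2])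
  fix \<omega> \<omega>' e assume *: "\<forall>t\<in>{0..T}. \<bar>canonical t \<omega>' - canonical t \<omega>\<bar> < e"
  have "modulus T \<delta> \<omega>1 \<le> modulus T \<delta> \<omega>2 + 2 * e"
    if "\<forall>t\<in>{0..T}. \<bar>canonical t \<omega>1 - canonical t \<omega>2\<bar> < e" for \<omega>1 \<omega>2
  proof (rule modulus_least[OF assms])
    fix p q assume pq: "0 \<le> p" "p \<le> q" "q \<le> T" "q - p \<le> \<delta>"
    show "\<bar>canonical q \<omega>1 - canonical p \<omega>1\<bar> \<le> modulus T \<delta> \<omega>2 + 2 * e"
      using modulus_upper[OF pq, of \<omega>2] that[rule_format, of p] that[rule_format, of q] pq by simp
  qed
  from this[of \<omega>' \<omega>] this[of \<omega> \<omega>'] show "\<bar>modulus T \<delta> \<omega>' - modulus T \<delta> \<omega>\<bar> \<le> 2 * e"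
    using * by (simp add: abs_minus_commute abs_le_iff)
qed

text \<open>Paths are uniformly continuous on the compact \<open>{0..T}\<close>.\<close>

lemma modulus_tendsto_0:
  assumes "0 \<le> T"
  shows "(\<lambda>n. modulus T (1 / real (Suc n)) \<omega>) \<longlonglongrightarrow> 0"
proof (rule LIMSEQ_I)
  fix r :: real assume "0 < r"
  have "uniformly_continuous_on {0..T} (\<lambda>s. canonical s \<omega>)"
    by (intro compact_uniformly_continuous continuous_on_canonical) auto
  then obtain d where d: "0 < d"
    "\<And>p q. p \<in> {0..T} \<Longrightarrow> q \<in> {0..T} \<Longrightarrow> dist q p < d \<Longrightarrow> dist (canonical q \<omega>) (canonical p \<omega>) < r / 2"
    unfolding uniformly_continuous_on_def using \<open>0 < r\<close> by (metis half_gt_zero)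
  obtain N where N: "1 / real (Suc N) < d" using d(1) nat_approx_posE by metis
  show "\<exists>no. \<forall>n\<ge>no. norm (modulus T (1 / real (Suc n)) \<omega> - 0) < r"
  proof (intro exI allI impI)
    fix n assume "N \<le> n"
    then have "1 / real (Suc n) \<le> 1 / real (Suc N)" by (intro divide_left_mono) auto
    then have "1 / real (Suc n) < d" using N by linarith
    have "modulus T (1 / real (Suc n)) \<omega> \<le> r / 2"
    proof (rule modulus_least[OF assms])
      fix p q assume "0 \<le> p" "p \<le> q" "q \<le> T" "q - p \<le> 1 / real (Suc n)"
      then show "\<bar>canonical q \<omega> - canonical p \<omega>\<bar> \<le> r / 2"
        using d(2)[of p q] \<open>1 / real (Suc n) < d\<close> by (auto simp: dist_real_def)
    qed simp
    then show "norm (modulus T (1 / real (Suc n)) \<omega> - 0) < r"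
      using modulus_nonneg[OF assms, of "1 / real (Suc n)" \<omega>] \<open>0 < r\<close> by simp
  qed
qed

section \<open>Dini's theorem over a weakly compact family of measures\<close>

text \<open>For each \<open>P\<close>, dominated convergence puts some integral below
  \<open>\<eta>\<close>. The sets \<open>U n\<close> of measures for which index \<open>n\<close>
  works are weakly open because \<open>f n\<close> is bounded and continuous, so finitely many of
  them cover \<open>PP\<close>.\<close>

lemma weakly_compact_Dini:
  fixes f :: "nat \<Rightarrow> 'a::topological_space \<Rightarrow> real"
  assumes PP: "compactin weak_topology PP" and "0 < \<eta>"
    and f: "\<And>n. continuous_on UNIV (f n)" and bound: "\<And>n x. \<bar>f n x\<bar> \<le> K"
    and dec: "\<And>m n x. m \<le> n \<Longrightarrow> f n x \<le> f m x" and lim: "\<And>x. (\<lambda>n. f n x) \<longlonglongrightarrow> 0"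
  shows "\<exists>n. \<forall>P\<in>PP. (\<integral>x. f n x \<partial>P) < \<eta>"
proof -
  have sub: "PP \<subseteq> topspace weak_topology" using PP by (rule compactin_subset_topspace)
  have prob: "prob_space P" "sets P = sets borel" if "P \<in> PP" for P
    using that sub by (auto simp: weak_topology_def)
  have meas: "f n \<in> borel_measurable P" if "P \<in> PP" for P n
    using borel_measurable_continuous_onI[OF f] measurable_cong_sets[OF prob(2)[OF that] refl] by blast
  have int: "integrable P (f n)" if "P \<in> PP" for P n
  proof -
    interpret prob_space P using prob(1)[OF that] .
    show ?thesis using bound meas[OF that] by (intro integrable_const_bound[of _ K]) auto
  qed
  define U where "U n = {P. prob_space P \<and> sets P = sets borel \<and> (\<integral>x. f n x \<partial>P) \<in> {..<\<eta>}}" for n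
  have openU: "openin weak_topology (U n)" for n
    unfolding weak_topology_def U_def using f bound
    by (intro topology_generated_by_Basis) (auto simp: bounded_iff intro!: exI[of _ "f n"] exI[of _ "{..<\<eta>}"])
  have cover: "PP \<subseteq> \<Union> (range U)"
  proof
    fix P assume P: "P \<in> PP"
    interpret prob_space P using prob(1)[OF P] .
    have "(\<lambda>n. \<integral>x. f n x \<partial>P) \<longlonglongrightarrow> (\<integral>x. 0 \<partial>P)"
      using meas[OF P] lim bound by (intro integral_dominated_convergence[of _ _ _ "\<lambda>_. K"]) auto
    then have "\<forall>\<^sub>F n in sequentially. (\<integral>x. f n x \<partial>P) < \<eta>"
      using \<open>0 < \<eta>\<close> by (intro order_tendstoD(2)[where y="\<integral>x. 0 \<partial>P"]) auto
    then obtain n where "(\<integral>x. f n x \<partial>P) < \<eta>" by (auto simp: eventually_sequentially)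
    then show "P \<in> \<Union> (range U)" using prob[OF P] by (auto simp: U_def)
  qed
  obtain \<F> where \<F>: "finite \<F>" "\<F> \<subseteq> range U" "PP \<subseteq> \<Union>\<F>"
    using PP cover openU unfolding compactin_def by (metis (no_types, lifting) imageE)
  then obtain I where I: "finite I" "\<F> = U ` I" by (metis finite_subset_image)
  \<comment> \<open>The largest index of the subcover serves every \<open>P\<close> since
    \<open>f\<close> decreases in \<open>n\<close>; inserting 0 keeps \<open>Max\<close> away from
    the empty set.\<close>
  have "(\<integral>x. f (Max (insert 0 I)) x \<partial>P) < \<eta>" if P: "P \<in> PP" for P
  proof -
    obtain n where n: "n \<in> I" "(\<integral>x. f n x \<partial>P) < \<eta>" using P \<F>(3) I(2) by (auto simp: U_def)
    have "(\<integral>x. f (Max (insert 0 I)) x \<partial>P) \<le> (\<integral>x. f n x \<partial>P)"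
      using n(1) I(1) by (intro integral_mono int[OF P] dec) auto
    then show ?thesis using n(2) by linarith
  qed
  then show ?thesis by blast
qed

section \<open>Closeness of partition sums to the quadratic variation, uniform in the
  partition\<close>

text \<open>\<open>tendsto_L\<close> places the sequence and its limit in \<open>Lspace\<close>, but
  bounding integrals by the norm of their difference requires the difference to lie there
  too.\<close>

lemma Lspace_2_diff:
  fixes PP :: "'a::topological_space measure set"
  assumes sets: "\<forall>P\<in>PP. sets P = sets borel"
    and X: "X \<in> Lspace PP 2" and Y: "Y \<in> Lspace PP 2"
  shows "(\<lambda>\<omega>. X \<omega> - Y \<omega>) \<in> Lspace PP 2"
proof -
  have [measurable]: "X \<in> borel_measurable borel" "Y \<in> borel_measurable borel"
    using X Y by (auto simp: Lspace_def)
  obtain C1 C2 where C0: "0 \<le> C1" "0 \<le> C2" and C: "\<And>P. P \<in> PP \<Longrightarrow> (\<integral>\<^sup>+\<omega>. ennreal ((X \<omega>)\<^sup>2) \<partial>P) \<le> ennreal C1"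
    "\<And>P. P \<in> PP \<Longrightarrow> (\<integral>\<^sup>+\<omega>. ennreal ((Y \<omega>)\<^sup>2) \<partial>P) \<le> ennreal C2"
    using X Y unfolding Lspace_iff[OF sets] by auto
  have sq: "(x - y)\<^sup>2 \<le> 2 * x\<^sup>2 + 2 * y\<^sup>2" for x y :: real
    using zero_le_power2[of "x + y"] by (simp add: power2_eq_square algebra_simps)
  have "(\<integral>\<^sup>+\<omega>. ennreal ((X \<omega> - Y \<omega>)\<^sup>2) \<partial>P) \<le> ennreal (2 * C1 + 2 * C2)"
    if P: "P \<in> PP" for P
  proof -
    note [measurable_cong] = bspec[OF sets P]
    have "(\<integral>\<^sup>+\<omega>. ennreal ((X \<omega> - Y \<omega>)\<^sup>2) \<partial>P)
        \<le> (\<integral>\<^sup>+\<omega>. ennreal 2 * ennreal ((X \<omega>)\<^sup>2) + ennreal 2 * ennreal ((Y \<omega>)\<^sup>2) \<partial>P)"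
      using sq by (intro nn_integral_mono) (simp add: ennreal_leI flip: ennreal_mult ennreal_plus ennreal_numeral)
    also have "\<dots> = ennreal 2 * (\<integral>\<^sup>+\<omega>. ennreal ((X \<omega>)\<^sup>2) \<partial>P) + ennreal 2 * (\<integral>\<^sup>+\<omega>. ennreal ((Y \<omega>)\<^sup>2) \<partial>P)"
      by (subst nn_integral_add) (auto simp: nn_integral_cmult)
    also have "\<dots> \<le> ennreal 2 * ennreal (C1) + ennreal 2 * ennreal (C2)"
      using C[OF P] by (intro add_mono mult_left_mono) (auto intro: order_trans ennreal_leI)
    also have "\<dots> = ennreal (2 * C1 + 2 * C2)"
      using C0 by (simp flip: ennreal_mult ennreal_plus ennreal_numeral)
    finally show ?thesis .
  qed
  then show ?thesis
    using C0 unfolding Lspace_iff[OF sets] by (auto intro!: exI[of _ "2 * C1 + 2 * C2"])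
qed

lemma Lspace_2_imp_1:
  fixes PP :: "'a::topological_space measure set"
  assumes PP: "\<forall>P\<in>PP. prob_space P \<and> sets P = sets borel" and X: "X \<in> Lspace PP 2"
  shows "X \<in> Lspace PP 1"
proof -
  have sets: "\<forall>P\<in>PP. sets P = sets borel" using PP by blast
  have [measurable]: "X \<in> borel_measurable borel" using X by (simp add: Lspace_def)
  obtain C where C: "\<And>P. P \<in> PP \<Longrightarrow> (\<integral>\<^sup>+\<omega>. ennreal ((X \<omega>)\<^sup>2) \<partial>P) \<le> ennreal C"
    using X unfolding Lspace_iff[OF sets] by auto
  \<comment> \<open>The maximum with 1 makes \<open>e\<close> positive, as a weight in
    \<open>nn_integral_abs_le_of_square\<close> must be.\<close>
  define e where "e = sqrt (max C 1)"
  have e: "0 < e" "C \<le> e\<^sup>2" by (auto simp: e_def)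
  have "(\<integral>\<^sup>+\<omega>. ennreal \<bar>X \<omega>\<bar> \<partial>P) \<le> ennreal e" if P: "P \<in> PP" for P
  proof (rule nn_integral_abs_le_of_square)
    note [measurable_cong] = bspec[OF sets P]
    show "X \<in> borel_measurable P" by measurable
    show "(\<integral>\<^sup>+\<omega>. ennreal ((X \<omega>)\<^sup>2) \<partial>P) \<le> ennreal (e\<^sup>2)"
      using C[OF P] ennreal_leI[OF e(2)] by (rule order_trans)
  qed (use bspec[OF PP P] e in auto)
  then show ?thesis
    using e(1) unfolding Lspace_iff[OF sets] by (auto intro!: exI[of _ e])
qed

text \<open>Convergence along the mesh filter yields one \<open>d\<close> for all partitions and all
  \<open>P\<close> at once. This uniformity later permits averaging over the shift of a
  grid.\<close>

lemma quadratic_variation_uniform: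
  fixes PP :: "'a::topological_space measure set"
  assumes sets: "\<forall>P\<in>PP. sets P = sets borel"
    and qv: "is_quadratic_variation PP X QV" and "0 \<le> T" "0 < e"
  obtains d where "0 < d"
    "\<And>n \<tau> P. \<tau> 0 = 0 \<Longrightarrow> \<tau> n = T \<Longrightarrow> (\<And>k. k < n \<Longrightarrow> \<tau> k \<le> \<tau> (Suc k) \<and> \<tau> (Suc k) - \<tau> k < d) \<Longrightarrow> P \<in> PP \<Longrightarrow>
      (\<integral>\<^sup>+\<omega>. ennreal (((\<Sum>k<n. (X (\<tau> (Suc k)) \<omega> - X (\<tau> k) \<omega>)\<^sup>2) - QV T \<omega>)\<^sup>2) \<partial>P) \<le> ennreal (e\<^sup>2)"
proof -
  define S where "S = (\<lambda>(n, \<tau>) \<omega>. \<Sum>k<n. (X (\<tau> (Suc k)) \<omega> - X (\<tau> k) \<omega>)\<^sup>2)"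
  have L: "tendsto_L PP 2 S (QV T) (partitions_mesh T)"
    using qv \<open>0 \<le> T\<close> by (simp add: is_quadratic_variation_def S_def)
  then have QV: "QV T \<in> Lspace PP 2" by (simp add: tendsto_L_def)
  have "\<forall>\<^sub>F i in partitions_mesh T. S i \<in> Lspace PP 2 \<and> Lnorm PP 2 (\<lambda>\<omega>. S i \<omega> - QV T \<omega>) < e"
    using L \<open>0 < e\<close> unfolding tendsto_L_def by (intro eventually_conj order_tendstoD(2)[of _ 0]) auto
  then obtain d where d: "0 < d" and
    ev: "\<And>n \<tau>. \<tau> 0 = 0 \<and> \<tau> n = T \<and> (\<forall>k<n. \<tau> k \<le> \<tau> (Suc k) \<and> \<tau> (Suc k) - \<tau> k < d) \<Longrightarrow>
      S (n, \<tau>) \<in> Lspace PP 2 \<and> Lnorm PP 2 (\<lambda>\<omega>. S (n, \<tau>) \<omega> - QV T \<omega>) < e"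
    \<comment> \<open>The sets of partitions shrink with \<open>d\<close>, so they form a filter
      base directed by \<open>min\<close>.\<close>
    unfolding partitions_mesh_def
    apply (subst (asm) eventually_INF_base)
    subgoal by auto
    subgoal for a b by (rule bexI[of _ "min a b"]) auto
    subgoal by (auto simp: eventually_principal)
    done
  show ?thesis
  proof (rule that[OF d])
    fix n \<tau> P assume \<tau>: "\<tau> 0 = 0" "\<tau> n = T" "\<And>k. k < n \<Longrightarrow> \<tau> k \<le> \<tau> (Suc k) \<and> \<tau> (Suc k) - \<tau> k < d"
      and P: "P \<in> PP"
    have *: "S (n, \<tau>) \<in> Lspace PP 2" "Lnorm PP 2 (\<lambda>\<omega>. S (n, \<tau>) \<omega> - QV T \<omega>) \<le> e"
      using ev[of \<tau> n] \<tau> by auto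
    show "(\<integral>\<^sup>+\<omega>. ennreal (((\<Sum>k<n. (X (\<tau> (Suc k)) \<omega> - X (\<tau> k) \<omega>)\<^sup>2) - QV T \<omega>)\<^sup>2) \<partial>P) \<le> ennreal (e\<^sup>2)"
      using nn_integral_square_le_Lnorm[OF Lspace_2_diff[OF sets *(1) QV] *(2) P] by (simp add: S_def)
  qed
qed

section \<open>Shifted grids stopped at both ends of the interval\<close>

text \<open>An arithmetic progression started one step early, at \<open>u - \<epsilon>\<close>, and
  clipped to \<open>{0..T}\<close>. For \<open>u \<le> \<epsilon>\<close> the first point is
  therefore 0. Clipping may repeat points, which \<open>partitions_mesh\<close> admits.\<close>

definition grid :: "real \<Rightarrow> real \<Rightarrow> real \<Rightarrow> nat \<Rightarrow> real" where
  "grid T \<epsilon> u k = max 0 (min T (u + (- \<epsilon> + real k * \<epsilon>)))"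

lemma grid_0: "u \<le> \<epsilon> \<Longrightarrow> grid T \<epsilon> u 0 = 0"
  by (simp add: grid_def)

text \<open>Index \<open>Suc m\<close> is \<open>u + m * \<epsilon>\<close> before clipping; the
  extra step compensates the early start.\<close>

lemma grid_last:
  assumes "0 \<le> u" "0 \<le> T" "T \<le> real m * \<epsilon>"
  shows "grid T \<epsilon> u (Suc m) = T"
  using assms by (simp add: grid_def algebra_simps)

lemma grid_step:
  assumes "0 \<le> \<epsilon>"
  shows "grid T \<epsilon> u k \<le> grid T \<epsilon> u (Suc k)" "grid T \<epsilon> u (Suc k) - grid T \<epsilon> u k \<le> \<epsilon>"
  using assms by (auto simp: grid_def algebra_simps)

text \<open>Clipping at 0 disappears because paths vanish at nonpositive times. The increment
  becomes a function of the single time \<open>u + (- \<epsilon> + k * \<epsilon>)\<close>, the form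
  required by \<open>integral_periodize\<close>.\<close>

lemma canonical_grid_increment:
  "canonical (grid T \<epsilon> u (Suc k)) \<omega> - canonical (grid T \<epsilon> u k) \<omega> =
    canonical (min T (u + (- \<epsilon> + real k * \<epsilon>) + \<epsilon>)) \<omega> - canonical (min T (u + (- \<epsilon> + real k * \<epsilon>))) \<omega>"
  by (simp add: grid_def canonical_max_0 algebra_simps)

section \<open>Moments of increments over short intervals\<close>

text \<open>A suitably shifted grid of step \<open>q - p\<close> has \<open>p\<close> and
  \<open>q\<close> as neighbours, so its sum of squares dominates the squared increment. That sum is
  within 1 of \<open>QV T\<close> in the second norm as soon as \<open>q - p < d\<close>, which
  makes the bound independent of \<open>p\<close> and \<open>q\<close>.\<close>

lemma fourth_moment_bound:
  assumes sets: "\<forall>P\<in>PP. sets P = sets borel"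
    and qv: "is_quadratic_variation PP canonical QV" and T: "0 \<le> T"
  obtains d C where "0 < d" "0 \<le> C"
    "\<And>P p q. P \<in> PP \<Longrightarrow> 0 \<le> p \<Longrightarrow> p \<le> q \<Longrightarrow> q \<le> T \<Longrightarrow> q - p < d \<Longrightarrow>
      (\<integral>\<^sup>+\<omega>. ennreal ((canonical q \<omega> - canonical p \<omega>) ^ 4) \<partial>P) \<le> ennreal C"
proof -
  define S where "S n \<tau> \<omega> = (\<Sum>k<n. (canonical (\<tau> (Suc k)) \<omega> - canonical (\<tau> k) \<omega>)\<^sup>2)" for n \<tau> \<omega>
  obtain d where d: "0 < d"
    "\<And>n \<tau> P. \<tau> 0 = 0 \<Longrightarrow> \<tau> n = T \<Longrightarrow> (\<And>k. k < n \<Longrightarrow> \<tau> k \<le> \<tau> (Suc k) \<and> \<tau> (Suc k) - \<tau> k < d) \<Longrightarrow> P \<in> PP \<Longrightarrow>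
      (\<integral>\<^sup>+\<omega>. ennreal ((S n \<tau> \<omega> - QV T \<omega>)\<^sup>2) \<partial>P) \<le> ennreal (1\<^sup>2)"
    using quadratic_variation_uniform[OF sets qv T zero_less_one] unfolding S_def by blast
  have QV: "QV T \<in> Lspace PP 2" using qv T by (auto simp: is_quadratic_variation_def tendsto_L_def)
  then have [measurable]: "QV T \<in> borel_measurable borel" by (simp add: Lspace_def)
  obtain C where C0: "0 \<le> C" and C: "\<And>P. P \<in> PP \<Longrightarrow> (\<integral>\<^sup>+\<omega>. ennreal ((QV T \<omega>)\<^sup>2) \<partial>P) \<le> ennreal C"
    using QV unfolding Lspace_iff[OF sets] by auto
  have "(\<integral>\<^sup>+\<omega>. ennreal ((canonical q \<omega> - canonical p \<omega>) ^ 4) \<partial>P) \<le> ennreal (2 + 2 * C)"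
    if P: "P \<in> PP" and pq: "0 \<le> p" "p \<le> q" "q \<le> T" "q - p < d" for P p q
  proof (cases "p = q")
    case False
    note [measurable_cong] = bspec[OF sets P]
    define \<epsilon> where "\<epsilon> = q - p"
    have \<epsilon>: "0 < \<epsilon>" "\<epsilon> < d" using False pq by (auto simp: \<epsilon>_def)
    define m where "m = nat \<lceil>T / \<epsilon>\<rceil>"
    have m: "T \<le> real m * \<epsilon>"
      using \<epsilon>(1) real_nat_ceiling_ge[of "T / \<epsilon>"] by (simp add: m_def field_simps)
    \<comment> \<open>The shift \<open>u\<close> is chosen so that \<open>p\<close> and \<open>q\<close> are consecutive grid points.\<close>
    define j where "j = nat \<lfloor>q / \<epsilon>\<rfloor>"
    define u where "u = q - real j * \<epsilon>"
    have j: "real j \<le> q / \<epsilon>" "q / \<epsilon> \<le> real j + 1" using pq \<epsilon> by (auto simp: j_def)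
    then have u: "0 \<le> u" "u \<le> \<epsilon>" using \<epsilon>(1) by (auto simp: u_def field_simps)
    have "real j * \<epsilon> \<le> real m * \<epsilon>" using u(1) pq(3) m by (simp add: u_def)
    then have "j < Suc m" using \<epsilon>(1) by simp
    let ?\<tau> = "grid T \<epsilon> u"
    have inc: "canonical (?\<tau> (Suc j)) \<omega> - canonical (?\<tau> j) \<omega> = canonical q \<omega> - canonical p \<omega>" for \<omega>
      unfolding canonical_grid_increment using pq by (simp add: u_def \<epsilon>_def)
    have le_S: "(canonical q \<omega> - canonical p \<omega>)\<^sup>2 \<le> S (Suc m) ?\<tau> \<omega>" for \<omega>
      unfolding S_def inc[symmetric] using \<open>j < Suc m\<close>
      by (intro member_le_sum[where f="\<lambda>k. (canonical (?\<tau> (Suc k)) \<omega> - canonical (?\<tau> k) \<omega>)\<^sup>2"]) auto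
    have four: "(canonical q \<omega> - canonical p \<omega>) ^ 4
        \<le> 2 * (S (Suc m) ?\<tau> \<omega> - QV T \<omega>)\<^sup>2 + 2 * (QV T \<omega>)\<^sup>2" for \<omega>
    proof -
      have "(canonical q \<omega> - canonical p \<omega>) ^ 4 = ((canonical q \<omega> - canonical p \<omega>)\<^sup>2)\<^sup>2"
        by (simp flip: power_mult)
      also have "\<dots> \<le> (S (Suc m) ?\<tau> \<omega>)\<^sup>2" using le_S by (intro power_mono) auto
      \<comment> \<open>The right side minus the left side is the square of the partition sum minus
        \<open>2 * QV T \<omega>\<close>.\<close>
      also have "\<dots> \<le> 2 * (S (Suc m) ?\<tau> \<omega> - QV T \<omega>)\<^sup>2 + 2 * (QV T \<omega>)\<^sup>2"
        using zero_le_power2[of "S (Suc m) ?\<tau> \<omega> - 2 * QV T \<omega>"]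
        by (simp add: power2_eq_square algebra_simps)
      finally show ?thesis .
    qed
    have [measurable]: "S (Suc m) ?\<tau> \<in> borel_measurable borel" unfolding S_def[abs_def] by measurable
    have "(\<integral>\<^sup>+\<omega>. ennreal ((canonical q \<omega> - canonical p \<omega>) ^ 4) \<partial>P)
        \<le> (\<integral>\<^sup>+\<omega>. ennreal 2 * ennreal ((S (Suc m) ?\<tau> \<omega> - QV T \<omega>)\<^sup>2) + ennreal 2 * ennreal ((QV T \<omega>)\<^sup>2) \<partial>P)"
      using four by (intro nn_integral_mono) (simp add: ennreal_leI flip: ennreal_mult ennreal_plus ennreal_numeral)
    also have "\<dots> = ennreal 2 * (\<integral>\<^sup>+\<omega>. ennreal ((S (Suc m) ?\<tau> \<omega> - QV T \<omega>)\<^sup>2) \<partial>P)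
        + ennreal 2 * (\<integral>\<^sup>+\<omega>. ennreal ((QV T \<omega>)\<^sup>2) \<partial>P)"
      by (subst nn_integral_add) (auto simp: nn_integral_cmult)
    also have "\<dots> \<le> ennreal 2 * ennreal (1\<^sup>2) + ennreal 2 * ennreal (C)"
    proof (intro add_mono mult_left_mono)
      show "(\<integral>\<^sup>+\<omega>. ennreal ((S (Suc m) ?\<tau> \<omega> - QV T \<omega>)\<^sup>2) \<partial>P) \<le> ennreal (1\<^sup>2)"
        using grid_0[OF u(2)] grid_last[OF u(1) T m] grid_step[of \<epsilon> T u] \<epsilon> P
        by (intro d(2)) (auto intro: order.strict_trans1)
      show "(\<integral>\<^sup>+\<omega>. ennreal ((QV T \<omega>)\<^sup>2) \<partial>P) \<le> ennreal (C)"
        by (rule C[OF P])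
    qed auto
    also have "\<dots> = ennreal (2 + 2 * C)"
      using C0 by (simp flip: ennreal_mult ennreal_plus ennreal_numeral)
    finally show ?thesis .
  qed simp
  with d(1) C0 that[of d "2 + 2 * C"] show ?thesis by simp
qed

text \<open>An increment of size \<open>x\<close> is split at a level \<open>K\<close>: below it,
  \<open>x^2\<close> is at most \<open>K^2 * min 1 x\<close>, which the truncated modulus controls
  uniformly by \<open>weakly_compact_Dini\<close>; above it, \<open>x^2\<close> is at most
  \<open>x^4 / K^2\<close>, which the fourth moment controls.\<close>

lemma small_increments:
  assumes PP: "compactin weak_topology PP" and T: "0 \<le> T" and "0 < \<eta>" and "0 < d" and C0: "0 \<le> C"
    and C: "\<And>P p q. P \<in> PP \<Longrightarrow> 0 \<le> p \<Longrightarrow> p \<le> q \<Longrightarrow> q \<le> T \<Longrightarrow> q - p < d \<Longrightarrow>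
      (\<integral>\<^sup>+\<omega>. ennreal ((canonical q \<omega> - canonical p \<omega>) ^ 4) \<partial>P) \<le> ennreal C"
  obtains \<delta> where "0 < \<delta>"
    "\<And>P p q. P \<in> PP \<Longrightarrow> 0 \<le> p \<Longrightarrow> p \<le> q \<Longrightarrow> q \<le> T \<Longrightarrow> q - p < \<delta> \<Longrightarrow>
      (\<integral>\<^sup>+\<omega>. ennreal ((canonical q \<omega> - canonical p \<omega>)\<^sup>2) \<partial>P) \<le> ennreal \<eta>"
proof -
  have PP': "prob_space P" "sets P = sets borel" if "P \<in> PP" for P
    using that compactin_subset_topspace[OF PP] by (auto simp: weak_topology_def)
  \<comment> \<open>Since \<open>K\<close> is at least 1 and at least \<open>2 * C / \<eta>\<close>,
    so is its square; hence the fourth moment term costs at most \<open>\<eta> / 2\<close>.\<close>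
  define K where "K = 1 + 2 * C / \<eta>"
  have K: "1 \<le> K" using \<open>0 < \<eta>\<close> C0 by (simp add: K_def)
  have CK: "C / K\<^sup>2 \<le> \<eta> / 2"
  proof -
    have "2 * C \<le> \<eta> * K" using \<open>0 < \<eta>\<close> C0 by (simp add: K_def field_simps)
    also have "\<dots> \<le> \<eta> * K\<^sup>2" using K \<open>0 < \<eta>\<close> by (intro mult_left_mono) (auto simp: power2_eq_square)
    finally show ?thesis using K by (simp add: field_simps)
  qed
  \<comment> \<open>Truncation at 1 makes the modulus bounded, hence a test function for the weak
    topology.\<close>
  define f where "f n \<omega> = min 1 (modulus T (1 / real (Suc n)) \<omega>)" for n \<omega>
  have f0: "0 \<le> f n \<omega>" for n \<omega> unfolding f_def using modulus_nonneg[OF T] by simp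
  have fc: "continuous_on UNIV (f n)" for n
    unfolding f_def[abs_def] by (intro continuous_intros continuous_on_modulus T) simp
  \<comment> \<open>The factor \<open>K^2\<close> in front of the modulus term turns this target
    into \<open>\<eta> / 2\<close>.\<close>
  have "\<exists>n. \<forall>P\<in>PP. (\<integral>\<omega>. f n \<omega> \<partial>P) < \<eta> / (2 * K\<^sup>2)"
  proof (rule weakly_compact_Dini[OF PP _ fc])
    show "0 < \<eta> / (2 * K\<^sup>2)" using K \<open>0 < \<eta>\<close> by simp
    show "\<bar>f n \<omega>\<bar> \<le> 1" for n \<omega> using f0[of n \<omega>] by (simp add: f_def)
    show "f n \<omega> \<le> f k \<omega>" if "k \<le> n" for k n \<omega>
      unfolding f_def using that by (intro min.mono modulus_mono T) (auto intro!: divide_left_mono)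
    show "(\<lambda>n. f n \<omega>) \<longlonglongrightarrow> 0" for \<omega>
      using tendsto_min[OF tendsto_const[of 1] modulus_tendsto_0[OF T, of \<omega>]] by (simp add: f_def)
  qed
  then obtain n where n: "\<And>P. P \<in> PP \<Longrightarrow> (\<integral>\<omega>. f n \<omega> \<partial>P) < \<eta> / (2 * K\<^sup>2)" by blast
  show ?thesis
  proof (rule that[of "min d (1 / real (Suc n))"])
    fix P p q assume P: "P \<in> PP" and pq: "0 \<le> p" "p \<le> q" "q \<le> T" "q - p < min d (1 / real (Suc n))"
    interpret prob_space P using PP'(1)[OF P] .
    note [measurable_cong] = PP'(2)[OF P]
    have [measurable]: "f n \<in> borel_measurable borel" by (rule borel_measurable_continuous_onI[OF fc])
    have pt: "(canonical q \<omega> - canonical p \<omega>)\<^sup>2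
        \<le> K\<^sup>2 * f n \<omega> + 1 / K\<^sup>2 * (canonical q \<omega> - canonical p \<omega>) ^ 4" for \<omega>
    proof -
      define x where "x = \<bar>canonical q \<omega> - canonical p \<omega>\<bar>"
      have "x \<le> modulus T (1 / real (Suc n)) \<omega>"
        unfolding x_def using pq by (intro modulus_upper) auto
      then have "min 1 x \<le> f n \<omega>" by (simp add: f_def)
      have "x\<^sup>2 \<le> K\<^sup>2 * min 1 x + 1 / K\<^sup>2 * x ^ 4"
      proof (cases "x \<le> K")
        case True
        have "x\<^sup>2 \<le> K\<^sup>2 * min 1 x"
        proof (cases "x \<le> 1")
          case True
          have "x\<^sup>2 \<le> 1 * x" using mult_right_mono[OF True, of x] by (simp add: x_def power2_eq_square)
          also have "\<dots> \<le> K\<^sup>2 * x" using K by (intro mult_right_mono) (auto simp: x_def)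
          finally show ?thesis using True by simp
        next
          case False
          then show ?thesis using \<open>x \<le> K\<close> by (simp add: power_mono)
        qed
        moreover have "0 \<le> 1 / K\<^sup>2 * x ^ 4" by simp
        ultimately show ?thesis by linarith
      next
        case False
        then have "K\<^sup>2 \<le> x\<^sup>2" using K by (intro power_mono) auto
        then have "K\<^sup>2 * x\<^sup>2 \<le> x\<^sup>2 * x\<^sup>2" by (intro mult_right_mono) auto
        then have "x\<^sup>2 \<le> 1 / K\<^sup>2 * x ^ 4" using K by (simp add: field_simps power2_eq_square power4_eq_xxxx)
        moreover have "0 \<le> K\<^sup>2 * min 1 x" by (simp add: x_def)
        ultimately show ?thesis by linarith
      qed
      also have "\<dots> \<le> K\<^sup>2 * f n \<omega> + 1 / K\<^sup>2 * x ^ 4"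
        using \<open>min 1 x \<le> f n \<omega>\<close> by (intro add_right_mono mult_left_mono) auto
      finally show ?thesis by (simp add: x_def)
    qed
    have "integrable P (f n)"
      using f0[of n] by (intro integrable_const_bound[of _ 1]) (auto simp: f_def)
    then have fn: "(\<integral>\<^sup>+\<omega>. ennreal (f n \<omega>) \<partial>P) \<le> ennreal (\<eta> / (2 * K\<^sup>2))"
      using n[OF P] f0 by (subst nn_integral_eq_integral) (auto intro: ennreal_leI)
    have "(\<integral>\<^sup>+\<omega>. ennreal ((canonical q \<omega> - canonical p \<omega>)\<^sup>2) \<partial>P)
        \<le> (\<integral>\<^sup>+\<omega>. ennreal (K\<^sup>2) * ennreal (f n \<omega>)
            + ennreal (1 / K\<^sup>2) * ennreal ((canonical q \<omega> - canonical p \<omega>) ^ 4) \<partial>P)"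
      using pt f0 by (intro nn_integral_mono) (simp add: ennreal_leI flip: ennreal_mult ennreal_plus)
    also have "\<dots> = ennreal (K\<^sup>2) * (\<integral>\<^sup>+\<omega>. ennreal (f n \<omega>) \<partial>P)
        + ennreal (1 / K\<^sup>2) * (\<integral>\<^sup>+\<omega>. ennreal ((canonical q \<omega> - canonical p \<omega>) ^ 4) \<partial>P)"
      by (subst nn_integral_add) (auto simp: nn_integral_cmult)
    also have "\<dots> \<le> ennreal (K\<^sup>2) * ennreal (\<eta> / (2 * K\<^sup>2)) + ennreal (1 / K\<^sup>2) * ennreal (C)"
    proof (intro add_mono mult_left_mono fn)
      show "(\<integral>\<^sup>+\<omega>. ennreal ((canonical q \<omega> - canonical p \<omega>) ^ 4) \<partial>P) \<le> ennreal (C)"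
        using pq by (intro C[OF P]) auto
    qed auto
    also have "\<dots> = ennreal (\<eta> / 2 + C / K\<^sup>2)"
      using K \<open>0 < \<eta>\<close> C0 by (simp flip: ennreal_mult ennreal_plus)
    also have "\<dots> \<le> ennreal \<eta>" using CK by (intro ennreal_leI) linarith
    finally show "(\<integral>\<^sup>+\<omega>. ennreal ((canonical q \<omega> - canonical p \<omega>)\<^sup>2) \<partial>P) \<le> ennreal \<eta>" .
  qed (use \<open>0 < d\<close> in simp)
qed

section \<open>The regularized quadratic variation as an average of partition sums\<close>

text \<open>A pathwise identity. By \<open>integral_periodize\<close> the averaged grid sums are the
  integral from \<open>-\<epsilon>\<close> to \<open>m * \<epsilon>\<close> of \<open>h\<close>, the
  squared increment with both times stopped at \<open>t\<close>. This integrand differs from the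
  unstopped one on \<open>{0..t}\<close> only near \<open>t\<close>; the second and third terms on
  the right correct the two ends.\<close>

lemma regularized_quadratic_variation_decomposition:
  assumes "0 \<le> t" "0 < \<epsilon>" "t \<le> real m * \<epsilon>"
  shows "(LBINT s:{0..t}. (canonical (s + \<epsilon>) \<omega> - canonical s \<omega>)\<^sup>2) =
    (LBINT u:{0..\<epsilon>}. \<Sum>k<Suc m. (canonical (grid t \<epsilon> u (Suc k)) \<omega> - canonical (grid t \<epsilon> u k) \<omega>)\<^sup>2)
    - (LBINT s:{-\<epsilon>..0}. (canonical (min t (s + \<epsilon>)) \<omega> - canonical (min t s) \<omega>)\<^sup>2)
    + (LBINT s:{max 0 (t - \<epsilon>)..t}. (canonical (s + \<epsilon>) \<omega> - canonical s \<omega>)\<^sup>2 - (canonical t \<omega> - canonical s \<omega>)\<^sup>2)"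
proof -
  define h where "h s = (canonical (min t (s + \<epsilon>)) \<omega> - canonical (min t s) \<omega>)\<^sup>2" for s
  define g where "g s = (canonical (s + \<epsilon>) \<omega> - canonical s \<omega>)\<^sup>2" for s
  have c: "continuous_on A (\<lambda>s. canonical (g s) \<omega>)" if "continuous_on A g" for A :: "real set" and g
    by (rule continuous_on_compose2[OF continuous_on_canonical[of UNIV] that]) auto
  have hc: "continuous_on A h" and gc: "continuous_on A g" for A
    unfolding h_def[abs_def] g_def[abs_def] by (intro continuous_intros c)+
  have i: "f integrable_on {x..y}" if "continuous_on UNIV f" for f :: "real \<Rightarrow> real" and x y
    using that by (meson integrable_continuous_real continuous_on_subset subset_UNIV)
  note combine = Henstock_Kurzweil_Integration.integral_combine
  have 1: "(LBINT u:{0..\<epsilon>}. \<Sum>k<Suc m. (canonical (grid t \<epsilon> u (Suc k)) \<omega> - canonical (grid t \<epsilon> u k) \<omega>)\<^sup>2)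
      = integral {-\<epsilon>..real m * \<epsilon>} h"
  proof -
    have "(LBINT u:{0..\<epsilon>}. \<Sum>k<Suc m. (canonical (grid t \<epsilon> u (Suc k)) \<omega> - canonical (grid t \<epsilon> u k) \<omega>)\<^sup>2)
       = integral {0..\<epsilon>} (\<lambda>u. \<Sum>k<Suc m. h (u + (- \<epsilon> + real k * \<epsilon>)))"
      unfolding canonical_grid_increment h_def
      by (intro set_lborel_integral_Icc continuous_intros c)
    also have "\<dots> = integral {- \<epsilon>..- \<epsilon> + real (Suc m) * \<epsilon>} h"
      using assms(2) by (intro integral_periodize hc) simp
    finally show ?thesis by (simp add: algebra_simps)
  qed
  have 2: "integral {-\<epsilon>..real m * \<epsilon>} h = integral {-\<epsilon>..0} h + integral {0..t} h"
  proof -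
    \<comment> \<open>From \<open>t\<close> on, both stopped times equal \<open>t\<close>, so
      \<open>h\<close> vanishes.\<close>
    have "integral {t..real m * \<epsilon>} h = integral {t..real m * \<epsilon>} (\<lambda>_. 0)"
      using assms(2) by (intro integral_cong) (auto simp: h_def)
    then show ?thesis
      using combine[of "-\<epsilon>" 0 "real m * \<epsilon>" h] combine[of 0 t "real m * \<epsilon>" h] assms i[OF hc] by simp
  qed
  have 3: "integral {0..t} g - integral {0..t} h
      = integral {max 0 (t - \<epsilon>)..t} (\<lambda>s. g s - h s)"
  proof -
    \<comment> \<open>Stopping has no effect while \<open>s + \<epsilon> \<le> t\<close>; if
      \<open>t < \<epsilon>\<close> the interval is the single point 0.\<close>
    have "integral {0..max 0 (t - \<epsilon>)} (\<lambda>s. g s - h s) = 0"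
    proof (cases "\<epsilon> \<le> t")
      case True
      then have "integral {0..max 0 (t - \<epsilon>)} (\<lambda>s. g s - h s) = integral {0..max 0 (t - \<epsilon>)} (\<lambda>_. 0)"
        using assms(2) by (intro integral_cong) (auto simp: g_def h_def min_absorb2 le_diff_eq)
      then show ?thesis by simp
    qed simp
    moreover have "integral {0..t} (\<lambda>s. g s - h s) = integral {0..t} g - integral {0..t} h"
      by (intro integral_diff i gc hc)
    ultimately show ?thesis
      using combine[of 0 "max 0 (t - \<epsilon>)" t "\<lambda>s. g s - h s"] assms i[OF continuous_on_diff[OF gc hc]]
      by simp
  qed
  have 4: "(LBINT s:{max 0 (t - \<epsilon>)..t}. (canonical (s + \<epsilon>) \<omega> - canonical s \<omega>)\<^sup>2 - (canonical t \<omega> - canonical s \<omega>)\<^sup>2)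
      = integral {max 0 (t - \<epsilon>)..t} (\<lambda>s. g s - h s)"
  proof -
    have "(LBINT s:{max 0 (t - \<epsilon>)..t}. (canonical (s + \<epsilon>) \<omega> - canonical s \<omega>)\<^sup>2 - (canonical t \<omega> - canonical s \<omega>)\<^sup>2)
        = integral {max 0 (t - \<epsilon>)..t} (\<lambda>s. (canonical (s + \<epsilon>) \<omega> - canonical s \<omega>)\<^sup>2 - (canonical t \<omega> - canonical s \<omega>)\<^sup>2)"
      by (intro set_lborel_integral_Icc continuous_intros c)
    also have "\<dots> = integral {max 0 (t - \<epsilon>)..t} (\<lambda>s. g s - h s)"
      by (intro integral_cong) (auto simp: g_def h_def min_def)
    finally show ?thesis .
  qed
  have 5: "(LBINT s:{0..t}. (canonical (s + \<epsilon>) \<omega> - canonical s \<omega>)\<^sup>2) = integral {0..t} g"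
    unfolding g_def by (intro set_lborel_integral_Icc continuous_intros c)
  have 6: "(LBINT s:{-\<epsilon>..0}. (canonical (min t (s + \<epsilon>)) \<omega> - canonical (min t s) \<omega>)\<^sup>2) = integral {-\<epsilon>..0} h"
    unfolding h_def by (intro set_lborel_integral_Icc continuous_intros c)
  show ?thesis unfolding 1 2 4 5 6 3[symmetric] by simp
qed

section \<open>Assembly of the error estimates, uniformly over the representing measures\<close>

theorem corollary6p1:
  fixes sl su :: real and PP :: "cpath measure set" and QV :: "real \<Rightarrow> cpath \<Rightarrow> real"
  assumes "0 < sl" and "sl < su"
    and "represents_G_expectation sl su PP"
    and "is_quadratic_variation PP canonical QV"
  shows "\<forall>t\<ge>0. tendsto_L PP 1
    (\<lambda>\<epsilon> \<omega>. (1 / \<epsilon>) * (LBINT s:{0..t}. (canonical (s + \<epsilon>) \<omega> - canonical s \<omega>)\<^sup>2))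
    (QV t) (at_right 0)"
proof (intro allI impI)
  fix t :: real assume t: "0 \<le> t"
  have ne: "PP \<noteq> {}" and cpt: "compactin weak_topology PP"
    using assms(3) by (auto simp: represents_G_expectation_def)
  have PP: "\<forall>P\<in>PP. prob_space P \<and> sets P = sets borel"
    using compactin_subset_topspace[OF cpt] by (auto simp: weak_topology_def)
  then have sets: "\<forall>P\<in>PP. sets P = sets borel" by blast
  have "QV t \<in> Lspace PP 2"
    using assms(4) t by (auto simp: is_quadratic_variation_def tendsto_L_def)
  then have QV1: "QV t \<in> Lspace PP 1" by (rule Lspace_2_imp_1[OF PP])
  then have [measurable]: "QV t \<in> borel_measurable borel" by (simp add: Lspace_def)
  obtain C where C0: "0 \<le> C" and C: "\<And>P. P \<in> PP \<Longrightarrow> (\<integral>\<^sup>+\<omega>. ennreal \<bar>QV t \<omega>\<bar> \<partial>P) \<le> ennreal C"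
    using QV1 unfolding Lspace_iff[OF sets] by auto
  define Z where "Z \<epsilon> \<omega> = (1 / \<epsilon>) * (LBINT s:{0..t}. (canonical (s + \<epsilon>) \<omega> - canonical s \<omega>)\<^sup>2)" for \<epsilon> \<omega>
  have [measurable]: "Z \<epsilon> \<in> borel_measurable borel" for \<epsilon>
    unfolding Z_def[abs_def] set_lebesgue_integral_def by measurable

  \<comment> \<open>The factor 4 collects \<open>e\<close> from the averaged grid sums,
    \<open>e\<close> from the correction at 0, and \<open>2 * e\<close> from the correction at
    \<open>t\<close>, whose integrand is a difference of two squared increments.\<close>
  have main: "\<exists>d>0. \<forall>\<epsilon>. 0 < \<epsilon> \<longrightarrow> \<epsilon> < d \<longrightarrow> (\<forall>P\<in>PP. (\<integral>\<^sup>+\<omega>. ennreal \<bar>Z \<epsilon> \<omega> - QV t \<omega>\<bar> \<partial>P) \<le> ennreal (4 * e))"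
    if e: "0 < e" for e
  proof -
    obtain d1 where d1: "0 < d1"
      "\<And>n \<tau> P. \<tau> 0 = 0 \<Longrightarrow> \<tau> n = t \<Longrightarrow> (\<And>k. k < n \<Longrightarrow> \<tau> k \<le> \<tau> (Suc k) \<and> \<tau> (Suc k) - \<tau> k < d1) \<Longrightarrow> P \<in> PP \<Longrightarrow>
        (\<integral>\<^sup>+\<omega>. ennreal (((\<Sum>k<n. (canonical (\<tau> (Suc k)) \<omega> - canonical (\<tau> k) \<omega>)\<^sup>2) - QV t \<omega>)\<^sup>2) \<partial>P) \<le> ennreal (e\<^sup>2)"
      using quadratic_variation_uniform[OF sets assms(4) t e] by blast
    \<comment> \<open>The horizon is \<open>t + 1\<close> because the increments reach up to
      \<open>s + \<epsilon>\<close>, beyond \<open>t\<close>.\<close>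
    have t1: "0 \<le> t + 1" using t by simp
    obtain d2 C' where d2: "0 < d2" "0 \<le> C'"
      "\<And>P p q. P \<in> PP \<Longrightarrow> 0 \<le> p \<Longrightarrow> p \<le> q \<Longrightarrow> q \<le> t + 1 \<Longrightarrow> q - p < d2 \<Longrightarrow>
        (\<integral>\<^sup>+\<omega>. ennreal ((canonical q \<omega> - canonical p \<omega>) ^ 4) \<partial>P) \<le> ennreal C'"
      using fourth_moment_bound[OF sets assms(4) t1] by blast
    obtain \<delta> where \<delta>: "0 < \<delta>"
      "\<And>P p q. P \<in> PP \<Longrightarrow> 0 \<le> p \<Longrightarrow> p \<le> q \<Longrightarrow> q \<le> t + 1 \<Longrightarrow> q - p < \<delta> \<Longrightarrow>
        (\<integral>\<^sup>+\<omega>. ennreal ((canonical q \<omega> - canonical p \<omega>)\<^sup>2) \<partial>P) \<le> ennreal e"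
      using small_increments[OF cpt t1 e d2] by blast
    \<comment> \<open>Clipping at 0 leaves the increment unchanged and does not lengthen the
      interval, so negative times, which occur in \<open>?H\<close>, are covered.\<close>
    have inc: "(\<integral>\<^sup>+\<omega>. ennreal ((canonical q \<omega> - canonical p \<omega>)\<^sup>2) \<partial>P) \<le> ennreal e"
      if "P \<in> PP" "p \<le> q" "q \<le> t + 1" "q - p < \<delta>" for P p q
    proof -
      have "(\<integral>\<^sup>+\<omega>. ennreal ((canonical (max 0 q) \<omega> - canonical (max 0 p) \<omega>)\<^sup>2) \<partial>P) \<le> ennreal e"
        using that \<delta>(1) t by (intro \<delta>(2)) auto
      then show ?thesis by (simp add: canonical_max_0)
    qed
    show ?thesis
    proof (intro exI conjI allI impI ballI)
      \<comment> \<open>\<open>d1\<close> controls the mesh of the grids, \<open>\<delta>\<close>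
        the increments at the ends, and 1 keeps \<open>s + \<epsilon>\<close> within the
        horizon.\<close>
      show "0 < min d1 (min \<delta> 1)" using d1(1) \<delta>(1) by simp
      fix \<epsilon> P assume \<epsilon>: "0 < \<epsilon>" "\<epsilon> < min d1 (min \<delta> 1)" and P: "P \<in> PP"
      interpret prob_space P using PP P by blast
      have sf: "sigma_finite_measure P" ..
      note [measurable_cong] = bspec[OF sets P]
      define m where "m = nat \<lceil>t / \<epsilon>\<rceil>"
      have m: "t \<le> real m * \<epsilon>"
        using \<epsilon>(1) real_nat_ceiling_ge[of "t / \<epsilon>"] by (simp add: m_def field_simps)
      define S where "S u \<omega> = (\<Sum>k<Suc m. (canonical (grid t \<epsilon> u (Suc k)) \<omega> - canonical (grid t \<epsilon> u k) \<omega>)\<^sup>2)" for u \<omega>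
      define h where "h s \<omega> = (canonical (min t (s + \<epsilon>)) \<omega> - canonical (min t s) \<omega>)\<^sup>2" for s \<omega>
      define g where "g s \<omega> = (canonical (s + \<epsilon>) \<omega> - canonical s \<omega>)\<^sup>2 - (canonical t \<omega> - canonical s \<omega>)\<^sup>2" for s \<omega>
      have [measurable]: "(\<lambda>x. S (fst x) (snd x)) \<in> borel_measurable (lborel \<Otimes>\<^sub>M P)"
        unfolding S_def grid_def by measurable
      have [measurable]: "(\<lambda>x. h (fst x) (snd x)) \<in> borel_measurable (lborel \<Otimes>\<^sub>M P)"
        unfolding h_def by measurable
      have [measurable]: "(\<lambda>x. g (fst x) (snd x)) \<in> borel_measurable (lborel \<Otimes>\<^sub>M P)"
        unfolding g_def by measurable
      have [measurable]: "S u \<in> borel_measurable P" for u unfolding S_def[abs_def] by measurable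
      let ?A = "\<lambda>\<omega>. LBINT u:{0..\<epsilon>}. S u \<omega> - QV t \<omega>"
      let ?H = "\<lambda>\<omega>. LBINT s:{-\<epsilon>..0}. h s \<omega>"
      let ?G = "\<lambda>\<omega>. LBINT s:{max 0 (t - \<epsilon>)..t}. g s \<omega>"
      \<comment> \<open>Writing \<open>\<epsilon> * QV t \<omega>\<close> as the integral of a
        constant moves the error inside the average, where it is bounded separately for each shift
        \<open>u\<close>.\<close>
      have eq: "Z \<epsilon> \<omega> - QV t \<omega> = (1 / \<epsilon>) * (?A \<omega> - ?H \<omega> + ?G \<omega>)" for \<omega>
      proof -
        have "set_integrable lborel {0..\<epsilon>} (\<lambda>u. S u \<omega>)"
          unfolding S_def grid_def
          by (intro borel_integrable_atLeastAtMost' continuous_intros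
              continuous_on_compose2[OF continuous_on_canonical[of UNIV]]) auto
        moreover have "set_integrable lborel {0..\<epsilon>} (\<lambda>u. QV t \<omega>)"
          by (intro borel_integrable_atLeastAtMost' continuous_intros)
        ultimately have "?A \<omega> = (LBINT u:{0..\<epsilon>}. S u \<omega>) - (LBINT u:{0..\<epsilon>}. QV t \<omega>)"
          by (rule set_integral_diff(2))
        moreover have "(LBINT u:{0..\<epsilon>}. QV t \<omega>) = \<epsilon> * QV t \<omega>"
          using \<epsilon>(1) by (simp add: set_integral_const)
        ultimately show ?thesis
          using regularized_quadratic_variation_decomposition[OF t \<epsilon>(1) m, of \<omega>] \<epsilon>(1)
          unfolding Z_def S_def[symmetric] h_def[symmetric] g_def[symmetric]
          by (simp add: field_simps)
      qed
      have A: "(\<integral>\<^sup>+\<omega>. ennreal \<bar>?A \<omega>\<bar> \<partial>P) \<le> ennreal e * emeasure lborel {0..\<epsilon>}"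
      proof (rule nn_integral_abs_set_integral_le[OF sf])
        fix u assume u: "u \<in> {0..\<epsilon>}"
        show "(\<integral>\<^sup>+\<omega>. ennreal \<bar>S u \<omega> - QV t \<omega>\<bar> \<partial>P) \<le> ennreal e"
        proof (rule nn_integral_abs_le_of_square[OF prob_space_axioms _ e])
          show "(\<integral>\<^sup>+\<omega>. ennreal ((S u \<omega> - QV t \<omega>)\<^sup>2) \<partial>P) \<le> ennreal (e\<^sup>2)"
            unfolding S_def using u grid_0[of u \<epsilon> t] grid_last[OF _ t m, of u] grid_step[of \<epsilon> t u] \<epsilon> P
            by (intro d1(2)) (auto intro: order.strict_trans1)
        qed measurable
      qed measurable
      have H: "(\<integral>\<^sup>+\<omega>. ennreal \<bar>?H \<omega>\<bar> \<partial>P) \<le> ennreal e * emeasure lborel {-\<epsilon>..0}"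
      proof (rule nn_integral_abs_set_integral_le[OF sf])
        fix s assume "s \<in> {-\<epsilon>..0}"
        then have "(\<integral>\<^sup>+\<omega>. ennreal (h s \<omega>) \<partial>P) \<le> ennreal e"
          unfolding h_def using \<epsilon> t by (intro inc[OF P]) auto
        then show "(\<integral>\<^sup>+\<omega>. ennreal \<bar>h s \<omega>\<bar> \<partial>P) \<le> ennreal e" by (simp add: h_def)
      qed measurable
      have G: "(\<integral>\<^sup>+\<omega>. ennreal \<bar>?G \<omega>\<bar> \<partial>P) \<le> ennreal (2 * e) * emeasure lborel {max 0 (t - \<epsilon>)..t}"
      proof (rule nn_integral_abs_set_integral_le[OF sf])
        fix s assume s: "s \<in> {max 0 (t - \<epsilon>)..t}"
        have "(\<integral>\<^sup>+\<omega>. ennreal \<bar>g s \<omega>\<bar> \<partial>P)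
            \<le> (\<integral>\<^sup>+\<omega>. ennreal ((canonical (s + \<epsilon>) \<omega> - canonical s \<omega>)\<^sup>2)
                + ennreal ((canonical t \<omega> - canonical s \<omega>)\<^sup>2) \<partial>P)"
          by (intro nn_integral_mono)
            (auto simp: g_def intro!: ennreal_leI abs_triangle_ineq4[THEN order_trans] simp flip: ennreal_plus)
        also have "\<dots> = (\<integral>\<^sup>+\<omega>. ennreal ((canonical (s + \<epsilon>) \<omega> - canonical s \<omega>)\<^sup>2) \<partial>P)
            + (\<integral>\<^sup>+\<omega>. ennreal ((canonical t \<omega> - canonical s \<omega>)\<^sup>2) \<partial>P)"
          by (rule nn_integral_add) measurable
        also have "\<dots> \<le> ennreal e + ennreal e"
          using s \<epsilon> by (intro add_mono inc[OF P]) auto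
        also have "\<dots> = ennreal (2 * e)" using e by (simp flip: ennreal_plus)
        finally show "(\<integral>\<^sup>+\<omega>. ennreal \<bar>g s \<omega>\<bar> \<partial>P) \<le> ennreal (2 * e)" .
      qed measurable
      have [measurable]: "?A \<in> borel_measurable P" "?H \<in> borel_measurable P" "?G \<in> borel_measurable P"
        unfolding set_lebesgue_integral_def S_def grid_def h_def g_def by measurable
      have "(\<integral>\<^sup>+\<omega>. ennreal \<bar>Z \<epsilon> \<omega> - QV t \<omega>\<bar> \<partial>P)
          \<le> (\<integral>\<^sup>+\<omega>. ennreal (1 / \<epsilon>) * (ennreal \<bar>?A \<omega>\<bar> + ennreal \<bar>?H \<omega>\<bar> + ennreal \<bar>?G \<omega>\<bar>) \<partial>P)"
      proof (rule nn_integral_mono)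
        fix \<omega>
        have "\<bar>?A \<omega> - ?H \<omega> + ?G \<omega>\<bar> \<le> \<bar>?A \<omega>\<bar> + \<bar>?H \<omega>\<bar> + \<bar>?G \<omega>\<bar>" by linarith
        then have "\<bar>Z \<epsilon> \<omega> - QV t \<omega>\<bar> \<le> (1 / \<epsilon>) * (\<bar>?A \<omega>\<bar> + \<bar>?H \<omega>\<bar> + \<bar>?G \<omega>\<bar>)"
          unfolding eq abs_mult using \<epsilon>(1) by (simp add: divide_right_mono)
        then show "ennreal \<bar>Z \<epsilon> \<omega> - QV t \<omega>\<bar>
            \<le> ennreal (1 / \<epsilon>) * (ennreal \<bar>?A \<omega>\<bar> + ennreal \<bar>?H \<omega>\<bar> + ennreal \<bar>?G \<omega>\<bar>)"
          using \<epsilon>(1) by (simp add: ennreal_leI flip: ennreal_mult ennreal_plus)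
      qed
      also have "\<dots> = ennreal (1 / \<epsilon>) * ((\<integral>\<^sup>+\<omega>. ennreal \<bar>?A \<omega>\<bar> \<partial>P) + (\<integral>\<^sup>+\<omega>. ennreal \<bar>?H \<omega>\<bar> \<partial>P)
          + (\<integral>\<^sup>+\<omega>. ennreal \<bar>?G \<omega>\<bar> \<partial>P))"
        by (simp add: nn_integral_cmult nn_integral_add)
      \<comment> \<open>All three time intervals have length at most \<open>\<epsilon>\<close>,
        which cancels the factor \<open>1 / \<epsilon>\<close>.\<close>
      also have "\<dots> \<le> ennreal (1 / \<epsilon>) * (ennreal e * ennreal \<epsilon> + ennreal e * ennreal \<epsilon> + ennreal (2 * e) * ennreal \<epsilon>)"
      proof (intro mult_left_mono add_mono)
        have "emeasure lborel {max 0 (t - \<epsilon>)..t} \<le> ennreal \<epsilon>"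
          using t \<epsilon>(1) by (subst emeasure_lborel_Icc) (auto intro!: ennreal_leI)
        then show "(\<integral>\<^sup>+\<omega>. ennreal \<bar>?G \<omega>\<bar> \<partial>P) \<le> ennreal (2 * e) * ennreal \<epsilon>"
          by (intro order_trans[OF G] mult_left_mono) auto
      qed (use A H \<epsilon>(1) in auto)
      also have "\<dots> = ennreal (4 * e)"
        using \<epsilon>(1) e by (simp add: field_simps flip: ennreal_mult ennreal_plus)
      finally show "(\<integral>\<^sup>+\<omega>. ennreal \<bar>Z \<epsilon> \<omega> - QV t \<omega>\<bar> \<partial>P) \<le> ennreal (4 * e)" .
    qed
  qed

  \<comment> \<open>Membership of \<open>Z \<epsilon>\<close> follows from its distance to
    \<open>QV t\<close> and the triangle inequality.\<close>
  have L1: "Z \<epsilon> \<in> Lspace PP 1" "(\<lambda>\<omega>. Z \<epsilon> \<omega> - QV t \<omega>) \<in> Lspace PP 1"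
    if c: "0 \<le> c" and b: "\<forall>P\<in>PP. (\<integral>\<^sup>+\<omega>. ennreal \<bar>Z \<epsilon> \<omega> - QV t \<omega>\<bar> \<partial>P) \<le> ennreal c" for \<epsilon> c
  proof -
    show "(\<lambda>\<omega>. Z \<epsilon> \<omega> - QV t \<omega>) \<in> Lspace PP 1" 
      using b c unfolding Lspace_iff[OF sets] by auto
    have "(\<integral>\<^sup>+\<omega>. ennreal \<bar>Z \<epsilon> \<omega>\<bar> \<partial>P) \<le> ennreal (c + C)" if P: "P \<in> PP" for P
    proof -
      note [measurable_cong] = bspec[OF sets P]
      have "(\<integral>\<^sup>+\<omega>. ennreal \<bar>Z \<epsilon> \<omega>\<bar> \<partial>P)
          \<le> (\<integral>\<^sup>+\<omega>. ennreal \<bar>Z \<epsilon> \<omega> - QV t \<omega>\<bar> + ennreal \<bar>QV t \<omega>\<bar> \<partial>P)"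
        by (intro nn_integral_mono) (simp add: ennreal_leI flip: ennreal_plus)
      also have "\<dots> = (\<integral>\<^sup>+\<omega>. ennreal \<bar>Z \<epsilon> \<omega> - QV t \<omega>\<bar> \<partial>P) + (\<integral>\<^sup>+\<omega>. ennreal \<bar>QV t \<omega>\<bar> \<partial>P)"
        by (rule nn_integral_add) measurable
      also have "\<dots> \<le> ennreal (c) + ennreal (C)"
        using b P C[OF P] by (intro add_mono) auto
      finally show ?thesis using c C0 by (simp flip: ennreal_plus)
    qed
    then show "Z \<epsilon> \<in> Lspace PP 1"
      using c C0 unfolding Lspace_iff[OF sets] by (auto intro!: exI[of _ "c + C"])
  qed
  have ev: "\<forall>\<^sub>F \<epsilon> in at_right 0. \<forall>P\<in>PP. (\<integral>\<^sup>+\<omega>. ennreal \<bar>Z \<epsilon> \<omega> - QV t \<omega>\<bar> \<partial>P) \<le> ennreal (4 * e)"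
    if "0 < e" for e
    using main[OF that] unfolding eventually_at_right_field by auto
  have "\<forall>\<^sub>F \<epsilon> in at_right 0. Z \<epsilon> \<in> Lspace PP 1"
    using ev[OF zero_less_one] by (rule eventually_mono) (rule L1(1)[of "4 * 1"], simp_all)
  moreover have "((\<lambda>\<epsilon>. Lnorm PP 1 (\<lambda>\<omega>. Z \<epsilon> \<omega> - QV t \<omega>)) \<longlongrightarrow> 0) (at_right 0)"
  proof (rule tendstoI)
    fix r :: real assume r: "0 < r"
    \<comment> \<open>With \<open>r / 8\<close> the bound is \<open>r / 2\<close>, which leaves room
      for the strict inequality.\<close>
    have "\<forall>\<^sub>F \<epsilon> in at_right 0. \<forall>P\<in>PP. (\<integral>\<^sup>+\<omega>. ennreal \<bar>Z \<epsilon> \<omega> - QV t \<omega>\<bar> \<partial>P) \<le> ennreal (4 * (r / 8))"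
      using r by (intro ev) simp
    then show "\<forall>\<^sub>F \<epsilon> in at_right 0. dist (Lnorm PP 1 (\<lambda>\<omega>. Z \<epsilon> \<omega> - QV t \<omega>)) 0 < r"
    proof (rule eventually_mono)
      fix \<epsilon> assume b: "\<forall>P\<in>PP. (\<integral>\<^sup>+\<omega>. ennreal \<bar>Z \<epsilon> \<omega> - QV t \<omega>\<bar> \<partial>P) \<le> ennreal (4 * (r / 8))"
      have "Lnorm PP 1 (\<lambda>\<omega>. Z \<epsilon> \<omega> - QV t \<omega>) \<le> 4 * (r / 8)"
        using r b by (intro Lnorm_1_le[OF ne L1(2)[OF _ b]]) auto
      moreover have "0 \<le> Lnorm PP 1 (\<lambda>\<omega>. Z \<epsilon> \<omega> - QV t \<omega>)" by (simp add: Lnorm_def)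
      ultimately show "dist (Lnorm PP 1 (\<lambda>\<omega>. Z \<epsilon> \<omega> - QV t \<omega>)) 0 < r" using r by simp
    qed
  qed
  ultimately show "tendsto_L PP 1
    (\<lambda>\<epsilon> \<omega>. (1 / \<epsilon>) * (LBINT s:{0..t}. (canonical (s + \<epsilon>) \<omega> - canonical s \<omega>)\<^sup>2)) (QV t) (at_right 0)"
    using QV1 unfolding tendsto_L_def Z_def by blast
qed

end
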